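(* Let $\lambda=\lambda_1\lambda_2\cdots\lambda_k\vdash n$ be an integer partition with $\lambda_1\ge\lambda_2\ge\cdots\ge\lambda_k>0$, and fix an even permutation $\omega$ on $[n]$ of cycle-type $\lambda$. Then the number of factorizations of $\omega$ into two $n$-cycles (i.e. the number of ordered pairs $(\sigma,\tau)$ of $n$-cycles on $[n]$ with $\sigma\tau=\omega$) equals $$2(n-1)!\sum_{\substack{j_2+\cdots+j_k=l,\ l\ge 0,\\ \lambda_t>j_t\ge 0}}(-1)^l\,\frac{l!}{(\lambda_1+l+1)_{l+1}}\binom{\lambda_2}{j_2}\cdots\binom{\lambda_k}{j_k}\,,$$ where the sum is over all tuples $(j_2,\ldots,j_k)$ of integers with $0\le j_t<\lambda_t$ for $2\le t\le k$, and $l=j_2+\cdots+j_k$.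
   Context: $(x)_m$ denotes the falling factorial $x(x-1)\cdots(x-m+1)$. The cycle-type of a permutation is the partition formed by the lengths of its disjoint cycles. An $n$-cycle on $[n]$ is a permutation consisting of a single cycle of length $n$. *)

theory Defs
  imports
    Complex_Main
    "HOL-Library.FuncSet"
    "HOL-Library.Multiset"
    "HOL-Combinatorics.Permutations"
    "HOL-Combinatorics.Orbits"
begin

text \<open>
  A partition of \<open>n\<close> with \<open>k\<close> parts is a function on \<open>{1..k}\<close>, so that the indices are those of
  \<open>\<lambda>\<^sub>1 \<ge> \<dots> \<ge> \<lambda>\<^sub>k > 0\<close>; the values outside \<open>{1..k}\<close> are irrelevant.
\<close>

definition int_partition :: "nat \<Rightarrow> nat \<Rightarrow> (nat \<Rightarrow> nat) \<Rightarrow> bool" where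
  "int_partition n k lam \<longleftrightarrow>
     (\<forall>t\<in>{1..k}. 0 < lam t) \<and>
     (\<forall>s\<in>{1..k}. \<forall>t\<in>{1..k}. s \<le> t \<longrightarrow> lam t \<le> lam s) \<and>
     (\<Sum>t=1..k. lam t) = n"

text \<open>
  Orbits are collected as a set first, so each cycle is counted once; fixed points contribute
  cycles of length 1.
\<close>

definition cycle_type :: "nat \<Rightarrow> (nat \<Rightarrow> nat) \<Rightarrow> nat multiset" where
  "cycle_type n p = image_mset card (mset_set (orbit p ` {1..n}))"

definition has_cycle_type :: "nat \<Rightarrow> (nat \<Rightarrow> nat) \<Rightarrow> nat \<Rightarrow> (nat \<Rightarrow> nat) \<Rightarrow> bool" where
  "has_cycle_type n p k lam \<longleftrightarrow> cycle_type n p = image_mset lam (mset_set {1..k})"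

text \<open>For \<open>n = 1\<close> the identity is an \<open>n\<close>-cycle.\<close>

definition n_cycle :: "nat \<Rightarrow> (nat \<Rightarrow> nat) \<Rightarrow> bool" where
  "n_cycle n p \<longleftrightarrow> p permutes {1..n} \<and> cyclic_on p {1..n}"

definition falling_factorial :: "'a::comm_ring_1 \<Rightarrow> nat \<Rightarrow> 'a" where
  "falling_factorial x m = (\<Prod>i<m. x - of_nat i)"

end

theory Submission
  imports Defs "HOL-Analysis.Henstock_Kurzweil_Integration"
begin

hide_const (open) Finite_Cartesian_Product.transpose

text \<open>
  The count is reduced to a signed sum over \<open>\<omega>\<close>-invariant sets. Summing
  \<open>(- 1) ^ card S * sign_on S p\<close> over the invariant sets \<open>S\<close> of a permutation \<open>p\<close> inside a set \<open>B\<close> detects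
  whether \<open>B\<close> contains a cycle of \<open>p\<close>, because every cycle contributes the factor \<open>1 - 1\<close>. Writing
  the condition that \<open>inv c \<circ> \<omega>\<close> is an \<open>n\<close>-cycle in this way and summing over the \<open>n\<close>-cycles \<open>c\<close>, one can
  first sum over the part of \<open>c\<close> on \<open>S\<close>, where all choices that give an \<open>n\<close>-cycle have the same sign.
  The remaining signed sums over permutations of a set \<open>U\<close> that agree with \<open>\<omega>\<close> on \<open>S \<subseteq> U\<close> vanish unless
  \<open>U\<close> has at most one point outside \<open>S\<close>. If \<open>N\<close> is the number of factorizations, this leads to
  \<open>n (n + 1) N = \<Sum> sign_on U \<omega> * (card U)! * (n - card U)!\<close>, the sum being over the \<open>\<omega>\<close>-invariant sets \<open>U\<close>.

  As \<open>u! (n - u)! / (n + 1)!\<close> is the integral of \<open>x ^ u * (1 - x) ^ (n - u)\<close> over \<open>[0, 1]\<close>, this says that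
  \<open>N\<close> is \<open>(n - 1)!\<close> times the integral of the product of the polynomials
  \<open>(1 - x) ^ \<lambda>\<^sub>t - (- x) ^ \<lambda>\<^sub>t\<close> over all \<open>t\<close>. For even \<open>\<omega>\<close> the substitution of \<open>1 - x\<close> for \<open>x\<close> shows that
  both terms of the factor for \<open>t = 1\<close> contribute equally, and expanding the other factors in powers of
  \<open>x\<close> gives the formula.
\<close>

section \<open>Cycles and invariant sets\<close>

text \<open>For a permutation of a finite \<open>A\<close> this says that every cycle inside
  \<open>A\<close> contains a point of \<open>T\<close>. The phrasing by invariant sets instead of
  orbits lets signed sums over invariant sets test it.\<close>

definition meets_cycles :: "('a \<Rightarrow> 'a) \<Rightarrow> 'a set \<Rightarrow> 'a set \<Rightarrow> bool" where
  "meets_cycles p A T \<longleftrightarrow> (\<forall>R. R \<subseteq> A - T \<longrightarrow> p ` R = R \<longrightarrow> R = {})"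

lemma meets_cyclesD:
  assumes "meets_cycles p A T" "R \<subseteq> A - T" "p ` R = R"
  shows "R = {}"
  using assms unfolding meets_cycles_def by simp

lemma permutes_restrict_id_invariant:
  assumes "p permutes A" "p ` R = R"
  shows "restrict_id p R permutes R"
  using assms by (intro permutes_restrict_id) (auto simp: bij_betw_def permutes_inj_on)

lemma permutes_image_Diff:
  assumes "p permutes A" "p ` R = R"
  shows "p ` (A - R) = A - R"
  using assms by (metis image_set_diff permutes_image permutes_inj)

lemma sign_compose_permutes:
  assumes "finite A" "p permutes A" "q permutes A"
  shows "sign (p \<circ> q) = sign p * sign q"
  using assms by (intro sign_compose) (auto simp: permutation_permutes)

lemma sign_on_Un:
  assumes "p permutes A" "finite A" "R \<subseteq> A" "S \<subseteq> A" "R \<inter> S = {}" "p ` R = R" "p ` S = S"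
  shows "sign_on (R \<union> S) p = sign_on R p * sign_on S p"
proof -
  have R: "restrict_id p R permutes A"
    by (rule permutes_subset[OF permutes_restrict_id_invariant[OF assms(1,6)] assms(3)])
  have S: "restrict_id p S permutes A"
    by (rule permutes_subset[OF permutes_restrict_id_invariant[OF assms(1,7)] assms(4)])
  have "p x \<in> S" if "x \<in> S" for x using that assms(7) by blast
  then have "restrict_id p (R \<union> S) = restrict_id p R \<circ> restrict_id p S"
    using assms(5) by (auto simp: restrict_id_def fun_eq_iff)
  then show ?thesis
    using sign_compose_permutes[OF assms(2) R S] by (simp add: sign_on_def)
qed

lemma image_transpose_fixed:
  assumes "x \<notin> R" "y \<notin> R"
  shows "transpose x y ` R = R"
proof -
  have "transpose x y ` R = id ` R"
    using assms by (intro image_cong) (auto simp: Transposition.transpose_def)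
  then show ?thesis by simp
qed

lemma image_transpose_exchange:
  assumes "x \<notin> R" "y \<in> R"
  shows "transpose x y ` R = insert x (R - {y})"
proof -
  have "transpose x y ` insert y (R - {y}) = insert x (R - {y})"
    unfolding image_insert using assms by (subst image_transpose_fixed) auto
  then show ?thesis using assms by (simp add: insert_absorb)
qed

text \<open>
  Left multiplication by \<open>transpose x (p x)\<close> cuts \<open>x\<close> out of its cycle and leaves the rest of the
  cycle structure untouched.
\<close>

lemma meets_cycles_delete:
  assumes p: "p permutes A" and x: "x \<in> A" "x \<notin> T"
  shows "meets_cycles p A T \<longleftrightarrow> p x \<noteq> x \<and> meets_cycles (transpose x (p x) \<circ> p) (A - {x}) T"
proof (cases "p x = x")
  case True
  then have "{x} \<subseteq> A - T" "p ` {x} = {x}" using x by auto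
  then have "\<not> meets_cycles p A T" using meets_cyclesD[of p A T "{x}"] by auto
  then show ?thesis using True by simp
next
  case False
  let ?q = "transpose x (p x) \<circ> p"
  have inj: "inj p" using p by (rule permutes_inj)
  have 1: "R = {}" if h: "meets_cycles ?q (A - {x}) T" and R: "R \<subseteq> A - T" "p ` R = R" for R
  proof -
    have iff: "x \<in> R \<longleftrightarrow> p x \<in> R" using R(2) inj by (metis inj_image_mem_iff)
    have "?q ` (R - {x}) = transpose x (p x) ` (R - {p x})"
      using R(2) inj by (metis image_comp image_empty image_insert image_set_diff)
    also have "\<dots> = R - {x}"
    proof (cases "x \<in> R")
      case True
      then have "transpose (p x) x ` (R - {p x}) = insert (p x) (R - {p x} - {x})"
        using False by (intro image_transpose_exchange) auto
      then show ?thesis using True False iff by (auto simp: transpose_commute)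
    next
      case F: False
      then show ?thesis using iff by (simp add: image_transpose_fixed)
    qed
    finally have "R - {x} = {}"
      using R(1) by (intro meets_cyclesD[OF h]) auto
    then have "R = {} \<or> R = {x}" by auto
    then show "R = {}" using R(2) False by auto
  qed
  have 2: "R = {}" if h: "meets_cycles p A T" and R: "R \<subseteq> A - {x} - T" "?q ` R = R" for R
  proof -
    have "p ` R = transpose x (p x) ` (?q ` R)" by (simp add: image_comp o_assoc)
    then have pR: "p ` R = transpose x (p x) ` R" by (simp only: R(2))
    have xR: "x \<notin> R" using R by auto
    show "R = {}"
    proof (cases "p x \<in> R")
      case True
      have "p ` insert x R = insert (p x) (transpose x (p x) ` R)" by (simp add: pR)
      also have "transpose x (p x) ` R = insert x (R - {p x})"
        using xR True by (rule image_transpose_exchange)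
      also have "insert (p x) \<dots> = insert x R" using True by auto
      finally have "insert x R = {}"
        using R(1) x by (intro meets_cyclesD[OF h]) auto
      then show ?thesis by simp
    next
      case False
      then have "transpose x (p x) ` R = R"
        using xR by (simp add: image_transpose_fixed)
      then show ?thesis
        using pR R(1) by (intro meets_cyclesD[OF h]) auto
    qed
  qed
  show ?thesis using 1 2 False unfolding meets_cycles_def by metis
qed

text \<open>The complement of the orbit of \<open>e\<close> is an invariant set avoiding
  \<open>e\<close>. Conversely, a nonempty invariant set contains an orbit, which is all of
  \<open>A\<close> when \<open>p\<close> is cyclic. Any point \<open>e\<close> can therefore serve
  as the mark.\<close>

lemma cyclic_on_iff_meets_cycles:
  assumes p: "p permutes A" "finite A" and e: "e \<in> A"
  shows "cyclic_on p A \<longleftrightarrow> meets_cycles p A {e}"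
proof -
  have self: "e \<in> orbit p e"
    using p by (intro permutation_self_in_orbit) (auto simp: permutation_permutes)
  have sub: "orbit p e \<subseteq> A" by (rule permutes_orbit_subset[OF p(1) e])
  have "p ` orbit p e \<subseteq> orbit p e" by (auto intro: orbit.step)
  then have inv: "p ` orbit p e = orbit p e"
    using p by (metis card_image endo_inj_surj finite_subset permutes_inj_on sub)
  show ?thesis
  proof
    assume c: "cyclic_on p A"
    show "meets_cycles p A {e}"
      unfolding meets_cycles_def
    proof (intro allI impI)
      fix R assume R: "R \<subseteq> A - {e}" "p ` R = R"
      show "R = {}"
      proof (rule ccontr)
        assume "R \<noteq> {}"
        then obtain r where r: "r \<in> R" by auto
        have "orbit p r \<subseteq> R"
        proof
          fix y assume "y \<in> orbit p r"
          then show "y \<in> R" by induct (use r R(2) in auto)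
        qed
        moreover have "orbit p r = A" using c r R by (intro orbit_cyclic_eq3) auto
        ultimately show False using e R by auto
      qed
    qed
  next
    assume h: "meets_cycles p A {e}"
    have "A - orbit p e \<subseteq> A - {e}" using self by auto
    then have "A - orbit p e = {}"
      using permutes_image_Diff[OF p(1) inv] by (rule meets_cyclesD[OF h])
    then show "cyclic_on p A" using sub e unfolding cyclic_on_def by blast
  qed
qed

text \<open>A point of \<open>A\<close> survives the deletion of \<open>x\<close>, so it can mark
  the cycle both before and after. This recursion drives the sign and the two counts that
  follow.\<close>

lemma cyclic_on_delete:
  assumes "p permutes insert x A" "finite A" "A \<noteq> {}" "x \<notin> A"
  shows "cyclic_on p (insert x A) \<longleftrightarrow> p x \<noteq> x \<and> cyclic_on (transpose x (p x) \<circ> p) A"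
proof -
  obtain e where e: "e \<in> A" using assms(3) by auto
  have "transpose x (p x) \<circ> p permutes A"
    by (rule permutes_insert_lemma[OF assms(1)])
  then have "cyclic_on (transpose x (p x) \<circ> p) A \<longleftrightarrow> meets_cycles (transpose x (p x) \<circ> p) A {e}"
    using assms(2) e by (intro cyclic_on_iff_meets_cycles)
  moreover have "cyclic_on p (insert x A) \<longleftrightarrow> meets_cycles p (insert x A) {e}"
    using assms e by (intro cyclic_on_iff_meets_cycles) auto
  moreover have "x \<noteq> e" using assms(4) e by auto
  ultimately show ?thesis
    using meets_cycles_delete[OF assms(1), of x "{e}"] assms(4) by simp
qed

text \<open>Deleting a point composes with one transposition and lowers the cardinality by one, so
  the product stays the same down to a single point. It is the contribution of one cycle to the
  signed sums below.\<close>

lemma sign_cyclic_on: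
  assumes "finite A" "A \<noteq> {}" "p permutes A" "cyclic_on p A"
  shows "(- 1) ^ card A * sign p = - 1"
  using assms
proof (induction A arbitrary: p rule: finite_ne_induct)
  case (singleton x)
  then have "p = id" by (simp add: permutes_sing)
  then show ?case by simp
next
  case (insert x A)
  let ?q = "transpose x (p x) \<circ> p"
  have q: "?q permutes A" by (rule permutes_insert_lemma[OF insert.prems(1)])
  have cyc: "p x \<noteq> x" "cyclic_on ?q A"
    using cyclic_on_delete[OF insert.prems(1)] insert.hyps insert.prems(2) by auto
  have "sign ?q = sign (transpose x (p x)) * sign p"
    using permutes_imp_permutation[OF _ insert.prems(1)] insert.hyps(1)
    by (intro sign_compose) (auto simp: permutation_swap_id)
  then have "sign ?q = - sign p" using cyc(1) by (simp add: sign_swap_id)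
  then have "(- 1) ^ card A * sign p = 1"
    using insert.IH[OF q cyc(2)] by (metis minus_minus mult_minus_right)
  then show ?case using insert.hyps by simp
qed

text \<open>A cycle on \<open>insert x A\<close> amounts to the image of \<open>x\<close>, which may
  be any point of \<open>A\<close>, and the cycle on \<open>A\<close> that remains after cutting out
  \<open>x\<close>.\<close>

lemma card_cyclic_on:
  assumes "finite A" "A \<noteq> {}"
  shows "card {p. p permutes A \<and> cyclic_on p A} = fact (card A - 1)"
  using assms
proof (induction A rule: finite_ne_induct)
  case (singleton x)
  have "cyclic_on id {x}" by (auto simp: cyclic_on_def orbit_eq_singleton_iff[THEN iffD2])
  then have "{p. p permutes {x} \<and> cyclic_on p {x}} = {id}" by (auto simp: permutes_sing)
  then show ?case by simp
next
  case (insert x A)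
  let ?C = "{p. p permutes A \<and> cyclic_on p A}"
  let ?D = "{p. p permutes insert x A \<and> cyclic_on p (insert x A)}"
  have "bij_betw (\<lambda>(b, p). transpose x b \<circ> p) (A \<times> ?C) ?D"
  proof (rule bij_betw_byWitness[where f' = "\<lambda>p. (p x, transpose x (p x) \<circ> p)"])
    have px: "p x = x" if "p permutes A" for p
      using that insert.hyps(3) by (rule permutes_not_in)
    show "\<forall>a\<in>A \<times> ?C. (\<lambda>p. (p x, transpose x (p x) \<circ> p)) ((\<lambda>(b, p). transpose x b \<circ> p) a) = a"
      by (auto simp: px o_assoc)
    show "\<forall>p\<in>?D. (\<lambda>(b, p). transpose x b \<circ> p) (p x, transpose x (p x) \<circ> p) = p"
      by (auto simp: o_assoc)
    show "(\<lambda>(b, p). transpose x b \<circ> p) ` (A \<times> ?C) \<subseteq> ?D"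
    proof clarify
      fix b p assume b: "b \<in> A" and p: "p permutes A" "cyclic_on p A"
      have perm: "transpose x b \<circ> p permutes insert x A"
        using b permutes_subset[OF p(1), of "insert x A"]
        by (intro permutes_compose permutes_swap_id) auto
      moreover have "cyclic_on (transpose x b \<circ> p) (insert x A)"
        using b p insert.hyps by (subst cyclic_on_delete[OF perm]) (auto simp: px o_assoc)
      ultimately show "transpose x b \<circ> p permutes insert x A \<and>
          cyclic_on (transpose x b \<circ> p) (insert x A)" ..
    qed
    show "(\<lambda>p. (p x, transpose x (p x) \<circ> p)) ` ?D \<subseteq> A \<times> ?C"
    proof clarify
      fix p assume p: "p permutes insert x A" "cyclic_on p (insert x A)"
      have "p x \<noteq> x" "cyclic_on (transpose x (p x) \<circ> p) A"
        using cyclic_on_delete[OF p(1)] insert.hyps p(2) by auto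
      moreover have "p x \<in> insert x A" using permutes_in_image[OF p(1)] by blast
      ultimately show "p x \<in> A \<and> transpose x (p x) \<circ> p \<in> ?C"
        using permutes_insert_lemma[OF p(1)] by auto
    qed
  qed
  then have "card ?D = card A * card ?C"
    by (simp flip: bij_betw_same_card add: card_cartesian_product)
  also have "\<dots> = fact (card A)"
    using insert.IH insert.hyps fact_reduce[of "card A", where 'a = nat] by (simp add: card_gt_0_iff)
  finally show ?case using insert.hyps by simp
qed

text \<open>As \<open>q\<close> fixes every point outside \<open>T\<close>, the transposition that
  cuts such a point out of \<open>p\<close> also cuts it out of \<open>p \<circ> q\<close>. Once
  only \<open>T\<close> is left, \<open>p \<circ> q\<close> runs through all cyclic permutations of
  \<open>T\<close>.\<close>

lemma card_cyclic_on_compose: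
  assumes "finite A" "T \<subseteq> A" "T \<noteq> {}" "p permutes A"
  shows "card {q. q permutes T \<and> cyclic_on (p \<circ> q) A} =
    (if meets_cycles p A T then fact (card T - 1) else 0)"
proof -
  have finT: "finite T" by (rule finite_subset[OF assms(2,1)])
  \<comment> \<open>Both \<open>D\<close> and \<open>p\<close> vary: the points of \<open>D\<close>
    are deleted one at a time, and each deletion changes the permutation.\<close>
  have main: "card {q. q permutes T \<and> cyclic_on (p \<circ> q) (T \<union> D)} =
      (if meets_cycles p (T \<union> D) T then fact (card T - 1) else 0)"
    if "finite D" "D \<inter> T = {}" "p permutes T \<union> D" for D p
    using that
  proof (induction D arbitrary: p rule: finite_induct)
    case empty
    have bij: "bij_betw (\<lambda>q. p \<circ> q) {q. q permutes T \<and> cyclic_on (p \<circ> q) T}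
        {c. c permutes T \<and> cyclic_on c T}"
      using empty(2) permutes_inv[of p T]
      by (intro bij_betw_byWitness[where f' = "\<lambda>c. inv p \<circ> c"])
        (auto simp: o_assoc permutes_inv_o permutes_compose)
    have "card {q. q permutes T \<and> cyclic_on (p \<circ> q) T} = fact (card T - 1)"
      unfolding bij_betw_same_card[OF bij] by (rule card_cyclic_on[OF finT assms(3)])
    moreover have "meets_cycles p T T" by (simp add: meets_cycles_def)
    ultimately show ?case by (simp only: Un_empty_right if_True)
  next
    case (insert x D)
    have x: "x \<notin> T" using insert.prems by auto
    have ins: "insert x (T \<union> D) = T \<union> insert x D" by auto
    have D: "finite (T \<union> D)" "x \<notin> T \<union> D" "T \<union> D \<noteq> {}"
      using insert.hyps insert.prems(1) finT assms(3) by simp_all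
    have p: "p permutes insert x (T \<union> D)" using insert.prems(2) by simp
    let ?p = "transpose x (p x) \<circ> p"
    have p': "?p permutes T \<union> D" by (rule permutes_insert_lemma[OF p])
    have "cyclic_on (p \<circ> q) (T \<union> insert x D) \<longleftrightarrow> p x \<noteq> x \<and> cyclic_on (?p \<circ> q) (T \<union> D)"
      if q: "q permutes T" for q
    proof -
      have "p \<circ> q permutes insert x (T \<union> D)"
        using p permutes_subset[OF q, of "insert x (T \<union> D)"] by (intro permutes_compose) auto
      then show ?thesis
        using cyclic_on_delete[of "p \<circ> q" x "T \<union> D"] D permutes_not_in[OF q x]
        by (simp add: o_assoc)
    qed
    then have sets: "{q. q permutes T \<and> cyclic_on (p \<circ> q) (T \<union> insert x D)} =
        (if p x = x then {} else {q. q permutes T \<and> cyclic_on (?p \<circ> q) (T \<union> D)})"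
      by auto
    have meets: "meets_cycles p (T \<union> insert x D) T \<longleftrightarrow> p x \<noteq> x \<and> meets_cycles ?p (T \<union> D) T"
      using meets_cycles_delete[OF p, of x T] x D(2) by simp
    have IH: "card {q. q permutes T \<and> cyclic_on (?p \<circ> q) (T \<union> D)} =
        (if meets_cycles ?p (T \<union> D) T then fact (card T - 1) else 0)"
      using insert.prems(1) by (intro insert.IH p') auto
    show ?case
      unfolding sets meets using IH by (cases "p x = x") (simp_all only: simp_thms if_True if_False card.empty)
  qed
  have TA: "T \<union> (A - T) = A" using assms(2) by auto
  show ?thesis
    by (rule main[of "A - T" p, unfolded TA]) (use assms in auto)
qed

section \<open>Signed sums over invariant sets\<close>

text \<open>
  A cycle of length \<open>m\<close> contributes \<open>(- 1) ^ m * (- 1) ^ (m - 1) = - 1\<close>, so adding and removing a fixed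
  minimal invariant set is a sign-reversing involution.
\<close>

lemma sum_signed_invariant_sets:
  assumes fin: "finite A" and p: "p permutes A" and B: "B \<subseteq> A"
  shows "(\<Sum>R | R \<subseteq> B \<and> p ` R = R. (- 1) ^ card R * sign_on R p) =
    (if \<exists>R. R \<subseteq> B \<and> R \<noteq> {} \<and> p ` R = R then 0 else 1)"
proof (cases "\<exists>R. R \<subseteq> B \<and> R \<noteq> {} \<and> p ` R = R")
  case False
  then have "{R. R \<subseteq> B \<and> p ` R = R} = {{}}" by auto
  moreover have "sign_on {} p = 1" by (simp add: sign_on_def restrict_id_def)
  ultimately show ?thesis using False by simp
next
  case True
  have finB: "finite B" using fin B finite_subset by auto
  obtain C where C: "C \<subseteq> B" "C \<noteq> {}" "p ` C = C"
    and min: "\<And>R. R \<subseteq> B \<Longrightarrow> R \<noteq> {} \<Longrightarrow> p ` R = R \<Longrightarrow> card C \<le> card R"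
    using ex_has_least_nat[of "\<lambda>R. R \<subseteq> B \<and> R \<noteq> {} \<and> p ` R = R" _ card] True by metis
  have finC: "finite C" using finB C(1) finite_subset by auto
  have minimal: "R = {} \<or> R = C" if "R \<subseteq> C" "p ` R = R" for R
    using min[of R] that C(1) finC by (meson card_seteq order_trans)
  obtain e where e: "e \<in> C" using C(2) by auto
  let ?q = "restrict_id p C"
  have q: "?q permutes C" by (rule permutes_restrict_id_invariant[OF p C(3)])
  \<comment> \<open>By minimality, an invariant subset of \<open>C\<close> that misses
    \<open>e\<close> is empty, so \<open>C\<close> is a single cycle.\<close>
  have "meets_cycles ?q C {e}"
    unfolding meets_cycles_def
  proof (intro allI impI)
    fix R assume R: "R \<subseteq> C - {e}" "?q ` R = R"
    have "?q ` R = p ` R" using R(1) by (intro image_cong) auto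
    then show "R = {}" using minimal[of R] R e by auto
  qed
  then have "cyclic_on ?q C"
    using cyclic_on_iff_meets_cycles[OF q finC e] by simp
  then have sgnC: "(- 1) ^ card C * sign_on C p = - 1"
    unfolding sign_on_def by (rule sign_cyclic_on[OF finC C(2) q])
  define f where "f R = (- 1) ^ card R * sign_on R p" for R
  let ?I = "{R. R \<subseteq> B \<and> p ` R = R}"
  let ?J = "{R. R \<subseteq> B \<and> p ` R = R \<and> C \<inter> R = {}}"
  have inj: "inj p" using p by (rule permutes_inj)
  \<comment> \<open>The intersection of an invariant set with \<open>C\<close> is invariant, hence
    empty or all of \<open>C\<close>. Adding \<open>C\<close> pairs the sets of the first kind with
    those of the second.\<close>
  have split: "?I = ?J \<union> (\<lambda>R. C \<union> R) ` ?J"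
  proof (intro equalityI subsetI)
    fix R assume R: "R \<in> ?I"
    have "p ` (C \<inter> R) = C \<inter> R" using R C(3) inj by (simp add: image_Int)
    then consider "C \<inter> R = {}" | "C \<inter> R = C" using minimal[of "C \<inter> R"] by auto
    then show "R \<in> ?J \<union> (\<lambda>R. C \<union> R) ` ?J"
    proof cases
      case 1
      then show ?thesis using R by simp
    next
      case 2
      then have "R = C \<union> (R - C)" by auto
      moreover have "p ` (R - C) = R - C" using R C(3) inj by (simp add: image_set_diff)
      then have "R - C \<in> ?J" using R by auto
      ultimately show ?thesis by blast
    qed
  next
    fix R assume "R \<in> ?J \<union> (\<lambda>R. C \<union> R) ` ?J"
    then consider "R \<in> ?J" | R' where "R = C \<union> R'" "R' \<in> ?J" by blast
    then show "R \<in> ?I"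
    proof cases
      case 1
      then show "R \<in> ?I" by simp
    next
      case 2
      have "p ` R = R" unfolding 2(1) image_Un C(3) using 2(2) by simp
      moreover have "R \<subseteq> B" using C(1) 2 by simp
      ultimately show "R \<in> ?I" by (intro CollectI conjI)
    qed
  qed
  have fin0: "finite ?J" using finB by simp
  have fC: "f (C \<union> R) = - f R" if R: "R \<in> ?J" for R
  proof -
    have "finite R" using R finB finite_subset by auto
    then have "card (C \<union> R) = card C + card R"
      using R finC by (simp add: card_Un_disjoint)
    moreover have "sign_on (C \<union> R) p = sign_on C p * sign_on R p"
      using R C B by (intro sign_on_Un[OF p fin]) auto
    ultimately have "f (C \<union> R) = ((- 1) ^ card C * sign_on C p) * f R"
      by (simp add: f_def power_add)
    then show ?thesis by (simp add: sgnC)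
  qed
  have "sum f ?I = sum f ?J + sum f ((\<lambda>R. C \<union> R) ` ?J)"
    unfolding split using fin0 C(2) by (intro sum.union_disjoint) auto
  also have "sum f ((\<lambda>R. C \<union> R) ` ?J) = (\<Sum>R\<in>?J. f (C \<union> R))"
    by (intro sum.reindex_cong[where l = "\<lambda>R. C \<union> R"]) (auto simp: inj_on_def)
  also have "\<dots> = - sum f ?J"
    unfolding sum_negf[symmetric] by (intro sum.cong refl fC)
  finally show ?thesis using True by (simp add: f_def)
qed

lemma meets_cycles_signed_sum:
  assumes "finite A" "p permutes A"
  shows "(\<Sum>R | R \<subseteq> A - T \<and> p ` R = R. (- 1) ^ card R * sign_on R p) =
    (if meets_cycles p A T then 1 else 0)"
  unfolding sum_signed_invariant_sets[OF assms Diff_subset] by (auto simp: meets_cycles_def)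

text \<open>The weight \<open>card S\<close> counts the points \<open>e \<in> S\<close>. For fixed
  \<open>e\<close> the sets avoiding \<open>e\<close> sum to the indicator of cyclicity, while the
  sum over all invariant sets is 0 because \<open>A\<close> itself is one; the sets containing
  \<open>e\<close> thus give minus the indicator. The weight later turns
  \<open>fact (card S - 1)\<close> into \<open>fact (card S)\<close>.\<close>

lemma cyclic_on_signed_sum:
  assumes "finite A" "A \<noteq> {}" "p permutes A"
  shows "(\<Sum>S | S \<subseteq> A \<and> p ` S = S. int (card S) * ((- 1) ^ card S * sign_on S p)) =
    (if cyclic_on p A then - int (card A) else 0)"
proof -
  define f where "f S = (- 1) ^ card S * sign_on S p" for S
  let ?I = "{S. S \<subseteq> A \<and> p ` S = S}"
  have finI: "finite ?I" using assms(1) by simp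
  have total: "sum f ?I = 0"
    unfolding f_def using sum_signed_invariant_sets[OF assms(1,3) subset_refl] assms(2)
      permutes_image[OF assms(3)] by auto
  have part: "(\<Sum>S\<in>?I. if e \<in> S then f S else 0) = - (if cyclic_on p A then 1 else 0)"
    if e: "e \<in> A" for e
  proof -
    have "sum f ?I = (\<Sum>S\<in>?I. if e \<in> S then f S else 0) + (\<Sum>S\<in>?I. if e \<in> S then 0 else f S)"
      by (subst sum.distrib[symmetric], intro sum.cong) auto
    also have "(\<Sum>S\<in>?I. if e \<in> S then 0 else f S) = (\<Sum>S | S \<subseteq> A - {e} \<and> p ` S = S. f S)"
      using finI by (intro sum.mono_neutral_cong_right) auto
    also have "\<dots> = (if cyclic_on p A then 1 else 0)"
      unfolding f_def meets_cycles_signed_sum[OF assms(1,3)]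
      by (simp only: cyclic_on_iff_meets_cycles[OF assms(3,1) e])
    finally show ?thesis using total by simp
  qed
  have "(\<Sum>S\<in>?I. int (card S) * f S) = (\<Sum>S\<in>?I. \<Sum>e\<in>A. if e \<in> S then f S else 0)"
  proof (intro sum.cong refl)
    fix S assume "S \<in> ?I"
    then have "A \<inter> {e. e \<in> S} = S" by auto
    then show "int (card S) * f S = (\<Sum>e\<in>A. if e \<in> S then f S else 0)"
      using assms(1) by (simp add: sum.If_cases)
  qed
  also have "\<dots> = (\<Sum>e\<in>A. \<Sum>S\<in>?I. if e \<in> S then f S else 0)" by (rule sum.swap)
  also have "\<dots> = (\<Sum>e\<in>A. - (if cyclic_on p A then 1 else 0))" by (intro sum.cong refl part)
  finally show ?thesis by (simp add: f_def)
qed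

section \<open>Permutations with prescribed values on a subset\<close>

definition extension_sign_sum :: "('a \<Rightarrow> 'a) \<Rightarrow> 'a set \<Rightarrow> 'a set \<Rightarrow> int" where
  "extension_sign_sum w U S = (\<Sum>p | p permutes U \<and> (\<forall>x\<in>S. p x = w x). sign p)"

lemma finite_permutes_conj: "finite A \<Longrightarrow> finite {p. p permutes A \<and> P p}"
  by (rule finite_subset[OF _ finite_permutations]) auto

text \<open>
  The substitution is \<open>c = p \<circ> q\<close>, where \<open>inv q\<close> is the restriction of \<open>inv c \<circ> w\<close> to \<open>S\<close>.
\<close>

lemma sum_cyclic_on_sign_fibre:
  assumes fin: "finite A" and w: "w permutes A" and S: "S \<subseteq> A"
  shows "(\<Sum>c | c permutes A \<and> cyclic_on c A \<and> (inv c \<circ> w) ` S = S. sign_on S (inv c \<circ> w)) =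
    (\<Sum>p | p permutes A \<and> (\<forall>x\<in>S. p x = w x). \<Sum>q | q permutes S \<and> cyclic_on (p \<circ> q) A. sign q)"
proof -
  let ?L = "{c. c permutes A \<and> cyclic_on c A \<and> (inv c \<circ> w) ` S = S}"
  let ?P = "{p. p permutes A \<and> (\<forall>x\<in>S. p x = w x)}"
  let ?Q = "\<lambda>p. {q. q permutes S \<and> cyclic_on (p \<circ> q) A}"
  let ?t = "\<lambda>c. restrict_id (inv c \<circ> w) S"
  have finS: "finite S" using fin S finite_subset by auto
  have t: "?t c permutes S" "?t c permutes A" if "c \<in> ?L" for c
  proof -
    have "inv c \<circ> w permutes A" using that w by (auto intro: permutes_compose permutes_inv)
    then show "?t c permutes S" using that by (intro permutes_restrict_id_invariant) auto
    then show "?t c permutes A" using S by (rule permutes_subset)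
  qed
  \<comment> \<open>Since \<open>p\<close> agrees with \<open>w\<close> on \<open>S\<close>,
    \<open>inv p \<circ> w\<close> is the identity there, and \<open>q\<close> can be recovered from
    \<open>p \<circ> q\<close>.\<close>
  have r: "?t (p \<circ> q) = inv q" if "p \<in> ?P" "q permutes S" for p q
  proof
    fix x
    have q: "q permutes A" using that(2) S by (rule permutes_subset)
    have p: "p permutes A" using that by simp
    have iq: "inv q permutes S" using that(2) by (rule permutes_inv)
    have "inv (p \<circ> q) = inv q \<circ> inv p"
      using p q by (intro o_inv_distrib permutes_bij)
    moreover have "inv p (w x) = x" if "x \<in> S" for x
      using \<open>p \<in> ?P\<close> that by (simp add: permutes_inv_eq[OF p])
    ultimately show "?t (p \<circ> q) x = inv q x"
      by (cases "x \<in> S") (simp_all add: permutes_not_in[OF iq])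
  qed
  have "(\<Sum>c\<in>?L. sign_on S (inv c \<circ> w)) = (\<Sum>(p, q)\<in>Sigma ?P ?Q. sign q)"
  proof (rule sum.reindex_bij_witness[where i = "\<lambda>(p, q). p \<circ> q" and j = "\<lambda>c. (c \<circ> ?t c, inv (?t c))"])
    fix c assume c: "c \<in> ?L"
    note tc = t[OF c]
    show "(case (c \<circ> ?t c, inv (?t c)) of (p, q) \<Rightarrow> p \<circ> q) = c"
      using permutes_inv_o(1)[OF tc(1)] by (simp add: comp_assoc)
    have "c permutes A" using c by simp
    then have "c \<circ> ?t c permutes A" using tc(2) by (intro permutes_compose)
    moreover have "(c \<circ> ?t c) x = w x" if "x \<in> S" for x
      using that permutes_inverses(1)[OF \<open>c permutes A\<close>] by simp
    moreover have "inv (?t c) permutes S" using tc(1) by (rule permutes_inv)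
    moreover have "cyclic_on (c \<circ> ?t c \<circ> inv (?t c)) A"
      using permutes_inv_o(1)[OF tc(1)] c by (simp add: comp_assoc)
    ultimately show "(c \<circ> ?t c, inv (?t c)) \<in> Sigma ?P ?Q" by blast
    show "(case (c \<circ> ?t c, inv (?t c)) of (p, q) \<Rightarrow> sign q) = sign_on S (inv c \<circ> w)"
      using sign_inverse[OF permutes_imp_permutation[OF finS tc(1)]]
      by (simp add: sign_on_def)
  next
    fix z assume z: "z \<in> Sigma ?P ?Q"
    obtain p q where pq: "z = (p, q)" "p \<in> ?P" "q permutes S" "cyclic_on (p \<circ> q) A"
      using z by blast
    have q: "q permutes A" using pq(3) S by (rule permutes_subset)
    have p: "p permutes A" using pq by simp
    note r' = r[OF pq(2,3)]
    have iq: "inv q permutes S" using pq(3) by (rule permutes_inv)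
    show "(\<lambda>c. (c \<circ> ?t c, inv (?t c))) (case z of (p, q) \<Rightarrow> p \<circ> q) = z"
      unfolding pq(1) prod.case r' using permutes_inv_o(1)[OF pq(3)] permutes_inv_inv[OF pq(3)]
      by (simp add: comp_assoc)
    have "(inv (p \<circ> q) \<circ> w) ` S = ?t (p \<circ> q) ` S" by (intro image_cong) auto
    also have "\<dots> = S" unfolding r' by (rule permutes_image[OF iq])
    finally show "(case z of (p, q) \<Rightarrow> p \<circ> q) \<in> ?L"
      using pq p q by (simp add: permutes_compose)
  qed
  also have "\<dots> = (\<Sum>p\<in>?P. \<Sum>q\<in>?Q p. sign q)"
    using fin finS by (intro sum.Sigma[symmetric]) (auto intro!: finite_permutes_conj)
  finally show ?thesis .
qed

text \<open>For fixed \<open>p\<close> every admissible \<open>q\<close> has the same sign, as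
  \<open>p \<circ> q\<close> is a cycle on all of \<open>A\<close>. The inner sum is that sign times
  the number of such \<open>q\<close>, given by \<open>card_cyclic_on_compose\<close>.\<close>

lemma sum_cyclic_on_sign_on:
  assumes fin: "finite A" and w: "w permutes A" and S: "S \<subseteq> A" "S \<noteq> {}"
  shows "(\<Sum>c | c permutes A \<and> cyclic_on c A \<and> (inv c \<circ> w) ` S = S. sign_on S (inv c \<circ> w)) =
    - ((- 1) ^ card A * fact (card S - 1) *
      (\<Sum>p | p permutes A \<and> (\<forall>x\<in>S. p x = w x). if meets_cycles p A S then sign p else 0))"
proof -
  have A: "A \<noteq> {}" using S by auto
  have inner: "(\<Sum>q | q permutes S \<and> cyclic_on (p \<circ> q) A. sign q) =
      - ((- 1) ^ card A * fact (card S - 1) * (if meets_cycles p A S then sign p else 0))"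
    if p: "p permutes A" for p
  proof -
    have "sign q = - ((- 1) ^ card A * sign p)"
      if q: "q permutes S" "cyclic_on (p \<circ> q) A" for q
    proof -
      have qA: "q permutes A" using q(1) S(1) by (rule permutes_subset)
      have "(- 1) ^ card A * sign (p \<circ> q) = - 1"
        using p qA q(2) by (intro sign_cyclic_on[OF fin A]) (auto intro: permutes_compose)
      then have "(- 1) ^ card A * (sign p * sign q) = - 1"
        by (simp only: sign_compose_permutes[OF fin p qA])
      then show ?thesis
        by (cases p rule: sign_cases; cases q rule: sign_cases) auto
    qed
    then have "(\<Sum>q | q permutes S \<and> cyclic_on (p \<circ> q) A. sign q) =
        (\<Sum>q | q permutes S \<and> cyclic_on (p \<circ> q) A. - ((- 1) ^ card A * sign p))"
      by (intro sum.cong refl) blast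
    also have "\<dots> = int (card {q. q permutes S \<and> cyclic_on (p \<circ> q) A}) * - ((- 1) ^ card A * sign p)"
      by (rule sum_constant)
    finally show ?thesis
      unfolding card_cyclic_on_compose[OF fin S p] by (simp add: mult_ac)
  qed
  show ?thesis
    unfolding sum_cyclic_on_sign_fibre[OF fin w S(1)] sum_distrib_left sum_negf[symmetric]
    by (intro sum.cong refl inner) simp
qed

text \<open>The indicator is expanded over the \<open>p\<close>-invariant sets \<open>R\<close>
  disjoint from \<open>S\<close>. Such a \<open>p\<close> splits into an arbitrary permutation of
  \<open>R\<close> and an extension of \<open>w\<close> from \<open>S\<close> to
  \<open>A - R\<close>. The sign on \<open>R\<close> occurs twice and cancels, so the first part is
  merely counted.\<close>

lemma sum_meets_cycles_sign:
  assumes fin: "finite A" and w: "w permutes A" and S: "S \<subseteq> A"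
  shows "(\<Sum>p | p permutes A \<and> (\<forall>x\<in>S. p x = w x). if meets_cycles p A S then sign p else 0) =
    (\<Sum>R | R \<subseteq> A - S. (- 1) ^ card R * fact (card R) * extension_sign_sum w (A - R) S)"
proof -
  let ?P = "{p. p permutes A \<and> (\<forall>x\<in>S. p x = w x)}"
  have finP: "finite ?P" using fin by (rule finite_permutes_conj)
  have step: "(if meets_cycles p A S then sign p else 0) =
      (\<Sum>R | R \<in> Pow (A - S) \<and> p ` R = R. (- 1) ^ card R * sign_on (A - R) p)" if "p \<in> ?P" for p
  proof -
    have p: "p permutes A" using that by simp
    have summand: "sign p * ((- 1) ^ card R * sign_on R p) = (- 1) ^ card R * sign_on (A - R) p"
      if R: "R \<subseteq> A - S" "p ` R = R" for R
    proof -
      have "sign_on (R \<union> (A - R)) p = sign_on R p * sign_on (A - R) p"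
        using R by (intro sign_on_Un[OF p fin] permutes_image_Diff[OF p]) auto
      moreover have "R \<union> (A - R) = A" using R by auto
      ultimately have "sign p = sign_on R p * sign_on (A - R) p"
        using sign_on_permutes[OF p subset_refl] by simp
      moreover have "sign_on R p * sign_on R p = 1" by (simp add: sign_on_def)
      ultimately show ?thesis by (simp add: mult_ac)
    qed
    have sgn: "(if meets_cycles p A S then sign p else 0) =
        sign p * (\<Sum>R | R \<subseteq> A - S \<and> p ` R = R. (- 1) ^ card R * sign_on R p)"
      unfolding meets_cycles_signed_sum[OF fin p] by simp
    show ?thesis
      unfolding sgn sum_distrib_left using summand by (intro sum.cong) simp_all
  qed
  have fibre: "(\<Sum>p | p \<in> ?P \<and> p ` R = R. (- 1) ^ card R * sign_on (A - R) p) =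
      (- 1) ^ card R * fact (card R) * extension_sign_sum w (A - R) S"
    if R: "R \<subseteq> A - S" for R
  proof -
    have RA: "R \<subseteq> A" using R by auto
    have finR: "finite R" using RA fin finite_subset by auto
    let ?G = "{p. p permutes A - R \<and> (\<forall>x\<in>S. p x = w x)}"
    have "(\<Sum>p | p \<in> ?P \<and> p ` R = R. sign_on (A - R) p) = (\<Sum>(p, q)\<in>?G \<times> {q. q permutes R}. sign p)"
    proof (rule sum.reindex_bij_witness[where i = "\<lambda>(p, q). p \<circ> q" and
            j = "\<lambda>p. (restrict_id p (A - R), restrict_id p R)"])
      fix p assume p: "p \<in> {p \<in> ?P. p ` R = R}"
      then have pA: "p permutes A" and pR: "p ` R = R" by auto
      have mem: "p x \<in> R \<longleftrightarrow> x \<in> R" for x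
        using pR permutes_inj[OF pA] by (metis inj_image_mem_iff)
      show "(case (restrict_id p (A - R), restrict_id p R) of (p, q) \<Rightarrow> p \<circ> q) = p"
        using mem permutes_not_in[OF pA] by (auto simp: fun_eq_iff restrict_id_def)
      have "restrict_id p (A - R) permutes A - R" "restrict_id p R permutes R"
        using permutes_restrict_id_invariant[OF pA] pR permutes_image_Diff[OF pA pR] by auto
      moreover have "restrict_id p (A - R) x = w x" if "x \<in> S" for x
      proof -
        have "x \<in> A - R" using that R S by auto
        then show ?thesis using p that by simp
      qed
      ultimately show "(restrict_id p (A - R), restrict_id p R) \<in> ?G \<times> {q. q permutes R}"
        by blast
      show "(case (restrict_id p (A - R), restrict_id p R) of (p, q) \<Rightarrow> sign p) = sign_on (A - R) p"
        by (simp add: sign_on_def)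
    next
      fix z assume z: "z \<in> ?G \<times> {q. q permutes R}"
      obtain p q where pq: "z = (p, q)" "p permutes A - R" "\<forall>x\<in>S. p x = w x" "q permutes R"
        using z by blast
      have p0: "p x = x" if "x \<in> R" for x using permutes_not_in[OF pq(2)] that by auto
      have q0: "q x = x" if "x \<notin> R" for x using permutes_not_in[OF pq(4)] that by auto
      have qR: "q x \<in> R \<longleftrightarrow> x \<in> R" for x using permutes_in_image[OF pq(4)] by auto
      have "restrict_id (p \<circ> q) (A - R) = p"
        using q0 permutes_not_in[OF pq(2)] by (auto simp: fun_eq_iff restrict_id_def)
      moreover have "restrict_id (p \<circ> q) R = q"
        using q0 p0 qR by (auto simp: fun_eq_iff restrict_id_def)
      ultimately show "(\<lambda>p. (restrict_id p (A - R), restrict_id p R)) (case z of (p, q) \<Rightarrow> p \<circ> q) = z"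
        by (simp add: pq(1))
      have "p \<circ> q permutes A"
        using permutes_subset[OF pq(2), of A] permutes_subset[OF pq(4) RA] by (intro permutes_compose) auto
      moreover have "(p \<circ> q) ` R = R"
      proof -
        have "(p \<circ> q) ` R = q ` R" using p0 qR by (intro image_cong) auto
        then show ?thesis using permutes_image[OF pq(4)] by simp
      qed
      moreover have "(p \<circ> q) x = w x" if "x \<in> S" for x
      proof -
        have "x \<notin> R" using that R by auto
        then show ?thesis using that pq(3) q0 by simp
      qed
      ultimately show "(case z of (p, q) \<Rightarrow> p \<circ> q) \<in> {p \<in> ?P. p ` R = R}"
        by (simp add: pq(1))
    qed
    also have "\<dots> = (\<Sum>p\<in>?G. \<Sum>q | q permutes R. sign p)"
      by (rule sum.cartesian_product[symmetric])
    also have "\<dots> = fact (card R) * extension_sign_sum w (A - R) S"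
      using card_permutations[OF refl finR] by (simp add: extension_sign_sum_def sum_distrib_left)
    finally show ?thesis by (simp add: sum_distrib_left[symmetric])
  qed
  have "(\<Sum>p\<in>?P. if meets_cycles p A S then sign p else 0) =
      (\<Sum>p\<in>?P. \<Sum>R | R \<in> Pow (A - S) \<and> p ` R = R. (- 1) ^ card R * sign_on (A - R) p)"
    by (intro sum.cong refl step)
  also have "\<dots> = (\<Sum>R\<in>Pow (A - S). \<Sum>p | p \<in> ?P \<and> p ` R = R. (- 1) ^ card R * sign_on (A - R) p)"
    using fin finP by (intro sum.swap_restrict) auto
  also have "\<dots> = (\<Sum>R\<in>Pow (A - S). (- 1) ^ card R * fact (card R) * extension_sign_sum w (A - R) S)"
    by (intro sum.cong refl fibre) simp
  finally show ?thesis by (simp add: Pow_def)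
qed

text \<open>
  Composition with \<open>transpose a b\<close> is a sign-reversing involution on the extensions.
\<close>

lemma extension_sign_sum_eq_0:
  assumes fin: "finite U" and ab: "a \<in> U" "b \<in> U" "a \<notin> S" "b \<notin> S" "a \<noteq> b"
  shows "extension_sign_sum w U S = 0"
proof -
  let ?P = "{p. p permutes U \<and> (\<forall>x\<in>S. p x = w x)}"
  let ?t = "transpose a b"
  have t: "?t permutes U" using ab by (intro permutes_swap_id)
  have mem: "p \<circ> ?t \<in> ?P" if "p \<in> ?P" for p
  proof -
    have "?t x = x" if "x \<in> S" for x using ab(3,4) that by (auto simp: Transposition.transpose_def)
    then show ?thesis using that permutes_compose[OF t] by simp
  qed
  have "sum sign ?P = (\<Sum>p\<in>?P. - sign p)"
  proof (rule sum.reindex_bij_witness[where i = "\<lambda>p. p \<circ> ?t" and j = "\<lambda>p. p \<circ> ?t"])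
    fix p assume p: "p \<in> ?P"
    show "p \<circ> ?t \<circ> ?t = p" by (simp add: comp_assoc)
    show "p \<circ> ?t \<in> ?P" using p by (rule mem)
    show "- sign (p \<circ> ?t) = sign p"
      using p sign_compose_permutes[OF fin _ t, of p] ab(5) by (simp add: sign_swap_id)
  next
    fix p assume p: "p \<in> ?P"
    show "p \<circ> ?t \<circ> ?t = p" by (simp add: comp_assoc)
    show "p \<circ> ?t \<in> ?P" using p by (rule mem)
  qed
  then show ?thesis by (simp add: extension_sign_sum_def sum_negf)
qed

text \<open>The cyclicity of \<open>inv c \<circ> w\<close> is written as a signed sum over its
  invariant sets \<open>S\<close>. After exchanging the sums over \<open>c\<close> and
  \<open>S\<close>, the two preceding reductions apply for each \<open>S\<close>.\<close>

lemma card_cyclic_factorizations_extensions: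
  assumes fin: "finite A" and A: "A \<noteq> {}" and w: "w permutes A"
  shows "int (card A) * int (card {c. c permutes A \<and> cyclic_on c A \<and> cyclic_on (inv c \<circ> w) A}) =
    (\<Sum>U\<in>Pow A. fact (card A - card U) * (\<Sum>S\<in>Pow U. (- 1) ^ (card U + card S) * fact (card S) * extension_sign_sum w U S))"
    (is "_ * int (card ?F) = _")
proof -
  let ?n = "card A"
  let ?C = "{c. c permutes A \<and> cyclic_on c A}"
  let ?\<Phi> = "\<lambda>S. \<Sum>c | c \<in> ?C \<and> (inv c \<circ> w) ` S = S. sign_on S (inv c \<circ> w)"
  let ?Z = "\<lambda>S. \<Sum>p | p permutes A \<and> (\<forall>x\<in>S. p x = w x). if meets_cycles p A S then sign p else 0"
  let ?g = "\<lambda>S c. int (card S) * ((- 1) ^ card S * sign_on S (inv c \<circ> w))"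
  have finC: "finite ?C" using fin by (rule finite_permutes_conj)
  \<comment> \<open>For empty \<open>S\<close> both sides are 0: the weight vanishes, and no
    permutation of a nonempty set has all its cycles meeting the empty set.\<close>
  have fibre: "int (card S) * ?\<Phi> S = - ((- 1) ^ ?n * fact (card S) * ?Z S)" if S: "S \<subseteq> A" for S
  proof (cases "S = {}")
    case True
    have "\<not> meets_cycles p A {}" if "p permutes A" for p
      using A meets_cyclesD[of p A "{}" A] permutes_image[OF that] by auto
    then have "?Z S = 0" unfolding True by (intro sum.neutral) auto
    then show ?thesis using True by simp
  next
    case False
    have "card S > 0" using False S fin finite_subset by (auto simp: card_gt_0_iff)
    then have "(fact (card S) :: int) = int (card S) * fact (card S - 1)" by (simp add: fact_reduce)
    moreover have "?\<Phi> S = - ((- 1) ^ ?n * fact (card S - 1) * ?Z S)"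
      using sum_cyclic_on_sign_on[OF fin w S False] by (simp add: conj_assoc)
    ultimately show ?thesis by (simp add: mult_ac)
  qed
  have "- (int ?n * int (card ?F)) = (\<Sum>c\<in>?C. if cyclic_on (inv c \<circ> w) A then - int ?n else 0)"
  proof -
    have "?C \<inter> {c. cyclic_on (inv c \<circ> w) A} = ?F" by auto
    then show ?thesis using finC by (simp add: sum.If_cases)
  qed
  also have "\<dots> = (\<Sum>c\<in>?C. \<Sum>S | S \<in> Pow A \<and> (inv c \<circ> w) ` S = S. ?g S c)"
  proof (intro sum.cong refl)
    fix c assume "c \<in> ?C"
    then have "inv c \<circ> w permutes A" using w by (auto intro: permutes_compose permutes_inv)
    from cyclic_on_signed_sum[OF fin A this]
    show "(if cyclic_on (inv c \<circ> w) A then - int ?n else 0) =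
        (\<Sum>S | S \<in> Pow A \<and> (inv c \<circ> w) ` S = S. ?g S c)" by (simp only: Pow_iff)
  qed
  also have "\<dots> = (\<Sum>S\<in>Pow A. \<Sum>c | c \<in> ?C \<and> (inv c \<circ> w) ` S = S. ?g S c)"
    using fin finC by (intro sum.swap_restrict) auto
  also have "\<dots> = (\<Sum>S\<in>Pow A. (- 1) ^ card S * (int (card S) * ?\<Phi> S))"
    by (intro sum.cong refl) (simp add: sum_distrib_left mult_ac)
  also have "\<dots> = (\<Sum>S\<in>Pow A. (- 1) ^ card S * - ((- 1) ^ ?n * fact (card S) * ?Z S))"
    by (intro sum.cong refl arg_cong2[where f = "(*)"] fibre) auto
  finally have "int ?n * int (card ?F) = (\<Sum>S\<in>Pow A. (- 1) ^ (?n + card S) * fact (card S) * ?Z S)"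
    by (simp add: sum_negf power_add mult_ac)
  also have "\<dots> = (\<Sum>S\<in>Pow A. \<Sum>U | U \<in> Pow A \<and> S \<subseteq> U.
      fact (?n - card U) * ((- 1) ^ (card U + card S) * fact (card S) * extension_sign_sum w U S))"
  proof (intro sum.cong refl)
    fix S assume "S \<in> Pow A"
    then have S: "S \<subseteq> A" by simp
    have "(- 1) ^ (?n + card S) * fact (card S) * ?Z S =
        (\<Sum>R | R \<subseteq> A - S. (- 1) ^ (?n + card S) * fact (card S) *
          ((- 1) ^ card R * fact (card R) * extension_sign_sum w (A - R) S))"
      unfolding sum_meets_cycles_sign[OF fin w S] by (simp add: sum_distrib_left)
    also have "\<dots> = (\<Sum>U | U \<in> Pow A \<and> S \<subseteq> U.
        fact (?n - card U) * ((- 1) ^ (card U + card S) * fact (card S) * extension_sign_sum w U S))"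
    \<comment> \<open>Passing to \<open>U = A - R\<close> preserves the sign, because
      \<open>card A + card R\<close> and \<open>card U\<close> have the same parity.\<close>
    proof (rule sum.reindex_bij_witness[where i = "\<lambda>U. A - U" and j = "\<lambda>R. A - R"])
      fix R assume R: "R \<in> {R. R \<subseteq> A - S}"
      then have RA: "R \<subseteq> A" by auto
      then show "A - (A - R) = R" by auto
      show "A - R \<in> {U. U \<in> Pow A \<and> S \<subseteq> U}" using R S by auto
      have le: "card R \<le> ?n" using RA fin by (rule card_mono[rotated])
      have cd: "card (A - R) = ?n - card R" using RA fin finite_subset by (intro card_Diff_subset) auto
      have "?n + card S + card R = (?n - card R + card S) + 2 * card R" using le by simp
      then have "(- 1 :: int) ^ (?n + card S + card R) = (- 1) ^ (?n - card R + card S)"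
        by (simp only: power_add power_mult) simp
      then show "fact (?n - card (A - R)) * ((- 1) ^ (card (A - R) + card S) * fact (card S) *
            extension_sign_sum w (A - R) S) =
          (- 1) ^ (?n + card S) * fact (card S) *
          ((- 1) ^ card R * fact (card R) * extension_sign_sum w (A - R) S)"
        using le unfolding cd by (simp add: power_add mult_ac)
    next
      fix U assume U: "U \<in> {U. U \<in> Pow A \<and> S \<subseteq> U}"
      then show "A - (A - U) = U" by auto
      show "A - U \<in> {R. R \<subseteq> A - S}" using U by auto
    qed
    finally show "(- 1) ^ (?n + card S) * fact (card S) * ?Z S = \<dots>" .
  qed
  also have "\<dots> = (\<Sum>U\<in>Pow A. \<Sum>S | S \<in> Pow A \<and> S \<subseteq> U.
      fact (?n - card U) * ((- 1) ^ (card U + card S) * fact (card S) * extension_sign_sum w U S))"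
    using fin by (intro sum.swap_restrict) auto
  also have "\<dots> = (\<Sum>U\<in>Pow A. fact (card A - card U) *
      (\<Sum>S\<in>Pow U. (- 1) ^ (card U + card S) * fact (card S) * extension_sign_sum w U S))"
    unfolding sum_distrib_left by (intro sum.cong refl) auto
  finally show ?thesis .
qed

text \<open>Two points of \<open>U\<close> outside \<open>S\<close> make the term vanish, so only
  \<open>S = U\<close> and the sets \<open>U - {a}\<close> survive. The latter carry a minus sign
  and the factorial of \<open>card U - 1\<close>.\<close>

lemma sum_extension_sign_sum:
  assumes fin: "finite U"
  shows "(\<Sum>S\<in>Pow U. (- 1) ^ (card U + card S) * fact (card S) * extension_sign_sum w U S) =
    fact (card U) * extension_sign_sum w U U -
    (\<Sum>a\<in>U. fact (card U - 1) * extension_sign_sum w U (U - {a}))"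
proof -
  define h where "h S = (- 1) ^ (card U + card S) * fact (card S) * extension_sign_sum w U S" for S
  have "sum h (Pow U) = sum h (insert U ((\<lambda>a. U - {a}) ` U))"
  proof (rule sum.mono_neutral_right)
    show "\<forall>S\<in>Pow U - insert U ((\<lambda>a. U - {a}) ` U). h S = 0"
    proof
      fix S assume S: "S \<in> Pow U - insert U ((\<lambda>a. U - {a}) ` U)"
      then obtain a where a: "a \<in> U" "a \<notin> S" by auto
      have "S \<noteq> U - {a}" using S a by auto
      then obtain b where "b \<in> U" "b \<notin> S" "a \<noteq> b" using S a by auto
      then show "h S = 0"
        unfolding h_def using extension_sign_sum_eq_0[OF fin a(1) _ a(2)] by simp
    qed
  qed (use fin in auto)
  also have "\<dots> = h U + sum h ((\<lambda>a. U - {a}) ` U)"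
    using fin by (intro sum.insert) auto
  also have "sum h ((\<lambda>a. U - {a}) ` U) = (\<Sum>a\<in>U. h (U - {a}))"
    by (intro sum.reindex_cong[where l = "\<lambda>a. U - {a}"]) (auto simp: inj_on_def)
  also have "h U = fact (card U) * extension_sign_sum w U U"
    by (simp add: h_def)
  also have "(\<Sum>a\<in>U. h (U - {a})) = (\<Sum>a\<in>U. - (fact (card U - 1) * extension_sign_sum w U (U - {a})))"
  proof (intro sum.cong refl)
    fix a assume a: "a \<in> U"
    then have "card (U - {a}) = card U - 1" "card U > 0" using fin by (auto simp: card_gt_0_iff)
    moreover from this have "card U + (card U - 1) = 2 * (card U - 1) + 1" by simp
    ultimately have "(- 1 :: int) ^ (card U + card (U - {a})) = - 1"
      by (simp only: power_add power_mult) simp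
    then show "h (U - {a}) = - (fact (card U - 1) * extension_sign_sum w U (U - {a}))"
      unfolding h_def using \<open>card (U - {a}) = card U - 1\<close> by simp
  qed
  finally show ?thesis by (simp add: h_def sum_negf)
qed

text \<open>
  Since \<open>(n + 1) (u - 1)! (n - u)! = (u - 1)! (n - u + 1)! + u! (n - u)!\<close>, the left-hand side is a sum of
  two copies, with weights \<open>W (u - 1)\<close> and \<open>W u\<close>. In the first one the extensions with \<open>p a = a\<close>, and in the
  second one those with \<open>p a = w a\<close>, are the \<open>w\<close>-invariant sets without and with \<open>a\<close>. Cutting \<open>p a\<close> out of
  its cycle matches the remaining terms of the first copy with those of the second copy, with opposite signs.
\<close>

lemma sum_almost_extension_sign_sum:
  assumes fin: "finite A" and w: "w permutes A" and a: "a \<in> A"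
  shows "int (card A + 1) * (\<Sum>U | U \<in> Pow A \<and> a \<in> U.
      fact (card A - card U) * (fact (card U - 1) * extension_sign_sum w U (U - {a}))) =
    (\<Sum>U\<in>Pow A. fact (card U) * fact (card A - card U) * extension_sign_sum w U U)"
proof -
  let ?n = "card A"
  define W :: "nat \<Rightarrow> int" where "W m = fact m * fact (?n - m)" for m
  let ?P = "\<lambda>U. {p. p permutes U \<and> (\<forall>x\<in>U - {a}. p x = w x)}"
  let ?Q = "\<lambda>U. {p. p permutes U \<and> (\<forall>x\<in>U. p x = w x)}"
  let ?X = "{U. U \<in> Pow A \<and> a \<in> U}"
  let ?Y = "Sigma ?X ?P"
  let ?V = "Sigma (Pow A) ?Q"
  have finX: "finite ?X" using fin by simp
  have finU: "finite U" if "U \<in> Pow A" for U using that fin finite_subset by auto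
  have finY: "finite ?Y"
    using finX finU by (intro finite_SigmaI) (auto intro!: finite_permutes_conj)
  have finV: "finite ?V"
    using fin finU by (intro finite_SigmaI) (auto intro!: finite_permutes_conj)
  have weight: "int (?n + 1) * (fact (?n - card U) * fact (card U - 1)) = W (card U - 1) + W (card U)"
    if U: "U \<in> ?X" for U
  proof -
    have "finite U" "U \<noteq> {}" "card U \<le> ?n" using U finU fin by (auto intro: card_mono)
    then obtain m where m: "card U = Suc m" "Suc m \<le> ?n" by (metis card_0_eq not0_implies_Suc)
    then have "?n - m = Suc (?n - Suc m)" by simp
    then have "(fact (?n - m) :: int) = int (?n - m) * fact (?n - Suc m)" by simp
    also have "int (?n - m) = int ?n - int m" using m by simp
    finally have factor: "(fact (?n - m) :: int) = (int ?n - int m) * fact (?n - Suc m)" .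
    show ?thesis
      unfolding W_def m(1) diff_Suc_1 factor fact_Suc by (simp add: algebra_simps)
  qed
  \<comment> \<open>The two copies: \<open>f\<close> carries the weight for \<open>card U\<close>
    and \<open>g\<close> the one for \<open>card U - 1\<close>.\<close>
  define f where "f = (\<lambda>(U :: 'a set, p :: 'a \<Rightarrow> 'a). sign p * W (card U))"
  define g where "g = (\<lambda>(U :: 'a set, p :: 'a \<Rightarrow> 'a). sign p * W (card U - 1))"
  have "int (?n + 1) * (\<Sum>U\<in>?X. fact (?n - card U) * (fact (card U - 1) * extension_sign_sum w U (U - {a})))
      = (\<Sum>U\<in>?X. (W (card U - 1) + W (card U)) * extension_sign_sum w U (U - {a}))"
    unfolding sum_distrib_left by (intro sum.cong refl) (simp only: weight[symmetric] mult_ac)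
  also have "\<dots> = (\<Sum>U\<in>?X. \<Sum>p\<in>?P U. g (U, p) + f (U, p))"
    unfolding extension_sign_sum_def by (simp add: f_def g_def sum_distrib_left algebra_simps)
  also have "\<dots> = (\<Sum>z\<in>?Y. g z + f z)"
    using finX finU by (subst sum.Sigma) (auto intro!: finite_permutes_conj sum.cong)
  also have "\<dots> = sum g ?Y + sum f ?Y" by (rule sum.distrib)
  also have "sum g ?Y = sum g {z \<in> ?Y. snd z a = a} + sum g {z \<in> ?Y. snd z a \<noteq> a}"
    by (subst sum.union_disjoint[symmetric]) (use finY in \<open>auto intro!: sum.cong\<close>)
  also have "sum f ?Y = sum f {z \<in> ?Y. snd z a = w a} + sum f {z \<in> ?Y. snd z a \<noteq> w a}"
    by (subst sum.union_disjoint[symmetric]) (use finY in \<open>auto intro!: sum.cong\<close>)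
  \<comment> \<open>Dropping the fixed point \<open>a\<close> lowers the cardinality by one, which
    turns the weight in \<open>g\<close> into the weight in \<open>f\<close>.\<close>
  also have "sum g {z \<in> ?Y. snd z a = a} = sum f {z \<in> ?V. a \<notin> fst z}"
  proof (rule sum.reindex_bij_witness[where i = "\<lambda>(U, p). (insert a U, p)" and j = "\<lambda>(U, p). (U - {a}, p)"])
    fix z assume z: "z \<in> {z \<in> ?Y. snd z a = a}"
    then obtain U p where zp: "z = (U, p)" "U \<subseteq> A" "a \<in> U" "p permutes U" "p a = a"
      and eq: "\<And>x. x \<in> U - {a} \<Longrightarrow> p x = w x" by auto
    have "p permutes U - {a}" using zp by (intro permutes_superset[OF zp(4)]) auto
    then show "(case z of (U, p) \<Rightarrow> (U - {a}, p)) \<in> {z \<in> ?V. a \<notin> fst z}"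
      using zp eq by auto
    show "(case case z of (U, p) \<Rightarrow> (U - {a}, p) of (U, p) \<Rightarrow> (insert a U, p)) = z"
      using zp by auto
    show "f (case z of (U, p) \<Rightarrow> (U - {a}, p)) = g z"
      using zp by (simp add: f_def g_def)
  next
    fix z assume z: "z \<in> {z \<in> ?V. a \<notin> fst z}"
    then obtain U p where zp: "z = (U, p)" "U \<subseteq> A" "a \<notin> U" "p permutes U"
      and eq: "\<And>x. x \<in> U \<Longrightarrow> p x = w x" by auto
    have "p permutes insert a U" using zp(4) by (rule permutes_imp_permutes_insert)
    moreover have "p a = a" using zp(3,4) by (simp add: permutes_not_in)
    ultimately show "(case z of (U, p) \<Rightarrow> (insert a U, p)) \<in> {z \<in> ?Y. snd z a = a}"
      using zp eq a by auto
    show "(case case z of (U, p) \<Rightarrow> (insert a U, p) of (U, p) \<Rightarrow> (U - {a}, p)) = z"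
      using zp by auto
  qed
  also have "{z \<in> ?Y. snd z a = w a} = {z \<in> ?V. a \<in> fst z}"
    by auto
  \<comment> \<open>With \<open>b = p a\<close>, the permutation
    \<open>q = p \<circ> transpose a b\<close> fixes \<open>b\<close> and sends \<open>a\<close> to
    \<open>w b\<close>. Hence \<open>b\<close> is recovered as \<open>inv w (q a)\<close>. The sign
    changes, and removing \<open>b\<close> from \<open>U\<close> matches the weights.\<close>
  also have "sum g {z \<in> ?Y. snd z a \<noteq> a} = (\<Sum>z\<in>{z \<in> ?Y. snd z a \<noteq> w a}. - f z)"
  proof (rule sum.reindex_bij_witness[where
        i = "\<lambda>(U, p). (insert (inv w (p a)) U, p \<circ> transpose a (inv w (p a)))" and
        j = "\<lambda>(U, p). (U - {p a}, p \<circ> transpose a (p a))"])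
    fix z assume z: "z \<in> {z \<in> ?Y. snd z a \<noteq> a}"
    then obtain U p where zp: "z = (U, p)" "U \<subseteq> A" "a \<in> U" "p permutes U" "p a \<noteq> a"
      and eq: "\<And>x. x \<in> U - {a} \<Longrightarrow> p x = w x" by auto
    define b where "b = p a"
    have b: "b \<in> U" "b \<noteq> a" using zp by (auto simp: b_def permutes_in_image)
    define q where "q = p \<circ> transpose a b"
    have qa: "q a = w b" and qb: "q b = b" using b eq[of b] by (simp_all add: q_def b_def)
    have "q permutes U"
      unfolding q_def using zp(3,4) b by (intro permutes_compose permutes_swap_id)
    then have q: "q permutes U - {b}"
      by (rule permutes_superset) (use qb in auto)
    have "q x = w x" if "x \<in> U - {b} - {a}" for x
      using that eq[of x] by (simp add: q_def)
    moreover have "q a \<noteq> w a"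
      using qa b(2) permutes_inj[OF w] by (simp add: inj_eq)
    ultimately show "(case z of (U, p) \<Rightarrow> (U - {p a}, p \<circ> transpose a (p a))) \<in> {z \<in> ?Y. snd z a \<noteq> w a}"
      using q b zp by (auto simp flip: b_def q_def)
    have "inv w (q a) = b" using qa permutes_inverses(2)[OF w] by simp
    moreover have "q \<circ> transpose a b = p" by (simp add: q_def comp_assoc)
    ultimately show "(case case z of (U, p) \<Rightarrow> (U - {p a}, p \<circ> transpose a (p a)) of
        (U, p) \<Rightarrow> (insert (inv w (p a)) U, p \<circ> transpose a (inv w (p a)))) = z"
      using b zp by (simp flip: b_def q_def add: insert_absorb)
    have "sign q = - sign p"
      unfolding q_def using sign_compose_permutes[OF finU zp(4) permutes_swap_id[of a U b]] zp b
      by (simp add: sign_swap_id)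
    moreover have "card (U - {b}) = card U - 1" using b by simp
    ultimately show "- f (case z of (U, p) \<Rightarrow> (U - {p a}, p \<circ> transpose a (p a))) = g z"
      using zp by (simp add: f_def g_def flip: b_def q_def)
  next
    fix z assume z: "z \<in> {z \<in> ?Y. snd z a \<noteq> w a}"
    then obtain U p where zp: "z = (U, p)" "U \<subseteq> A" "a \<in> U" "p permutes U" "p a \<noteq> w a"
      and eq: "\<And>x. x \<in> U - {a} \<Longrightarrow> p x = w x" by auto
    define b where "b = inv w (p a)"
    have wb: "w b = p a" by (simp add: b_def permutes_inverses(1)[OF w])
    have ba: "b \<noteq> a" using wb zp(5) by auto
    \<comment> \<open>If \<open>b\<close> were in \<open>U\<close>, then
      \<open>p b = w b = p a\<close> would contradict injectivity. So the inverse map really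
      enlarges \<open>U\<close>.\<close>
    have bU: "b \<notin> U"
    proof
      assume "b \<in> U"
      then have "p b = p a" using eq[of b] ba wb by simp
      then show False using permutes_inj[OF zp(4)] ba by (simp add: inj_eq)
    qed
    have "p a \<in> A" using zp by (auto simp: permutes_in_image)
    then have bA: "b \<in> A" unfolding b_def using permutes_in_image[OF permutes_inv[OF w]] by simp
    define q where "q = p \<circ> transpose a b"
    have pb: "p b = b" using zp(4) bU by (simp add: permutes_not_in)
    have qa: "q a = b" and qb: "q b = p a" by (simp_all add: q_def pb)
    have q: "q permutes insert b U"
      unfolding q_def using zp(3) permutes_imp_permutes_insert[OF zp(4)]
      by (intro permutes_compose permutes_swap_id) auto
    have "q x = w x" if "x \<in> insert b U - {a}" for x
      using that eq[of x] qb wb by (cases "x = b") (simp_all add: q_def)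
    then show "(case z of (U, p) \<Rightarrow> (insert (inv w (p a)) U, p \<circ> transpose a (inv w (p a)))) \<in>
        {z \<in> ?Y. snd z a \<noteq> a}"
      using q bA zp ba qa by (auto simp flip: b_def q_def)
    have "q \<circ> transpose a b = p" by (simp add: q_def comp_assoc)
    then show "(case case z of (U, p) \<Rightarrow> (insert (inv w (p a)) U, p \<circ> transpose a (inv w (p a))) of
        (U, p) \<Rightarrow> (U - {p a}, p \<circ> transpose a (p a))) = z"
      using qa bU zp by (simp flip: b_def q_def)
  qed
  also have "sum f {z \<in> ?V. a \<notin> fst z} + (\<Sum>z\<in>{z \<in> ?Y. snd z a \<noteq> w a}. - f z) +
      (sum f {z \<in> ?V. a \<in> fst z} + sum f {z \<in> ?Y. snd z a \<noteq> w a}) =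
      sum f {z \<in> ?V. a \<notin> fst z} + sum f {z \<in> ?V. a \<in> fst z}"
    by (simp add: sum_negf)
  also have "\<dots> = sum f ?V"
    by (subst sum.union_disjoint[symmetric]) (use finV in \<open>auto intro!: sum.cong\<close>)
  also have "\<dots> = (\<Sum>U\<in>Pow A. \<Sum>p\<in>?Q U. f (U, p))"
    using fin finU by (subst sum.Sigma) (auto intro!: finite_permutes_conj)
  also have "\<dots> = (\<Sum>U\<in>Pow A. fact (card U) * fact (?n - card U) * extension_sign_sum w U U)"
    unfolding extension_sign_sum_def by (simp add: f_def W_def sum_distrib_left mult_ac)
  finally show ?thesis .
qed

lemma extension_sign_sum_self:
  assumes "w permutes A"
  shows "extension_sign_sum w U U = (if w ` U = U then sign_on U w else 0)"
proof -
  have "{p. p permutes U \<and> (\<forall>x\<in>U. p x = w x)} = (if w ` U = U then {restrict_id w U} else {})"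
  proof -
    have "p = restrict_id w U \<and> w ` U = U" if "p permutes U" "\<forall>x\<in>U. p x = w x" for p
    proof
      show "p = restrict_id w U"
        using that permutes_not_in[OF that(1)] by (auto simp: fun_eq_iff restrict_id_def)
      have "w ` U = p ` U" using that(2) by (intro image_cong) auto
      then show "w ` U = U" using permutes_image[OF that(1)] by simp
    qed
    then show ?thesis using permutes_restrict_id_invariant[OF assms] by auto
  qed
  then show ?thesis by (simp add: extension_sign_sum_def sign_on_def)
qed

text \<open>With \<open>W\<close> the signed sum over invariant sets, multiplying the previous count
  by \<open>card A + 1\<close> turns the correction for each \<open>a \<in> A\<close> into exactly
  one copy of \<open>W\<close>. This leaves
  \<open>(card A + 1) * W - card A * W = W\<close>.\<close>

theorem card_cyclic_factorizations:
  assumes fin: "finite A" and A: "A \<noteq> {}" and w: "w permutes A"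
  shows "int (card A) * int (card A + 1) *
      int (card {c. c permutes A \<and> cyclic_on c A \<and> cyclic_on (inv c \<circ> w) A}) =
    (\<Sum>U | U \<subseteq> A \<and> w ` U = U. fact (card U) * fact (card A - card U) * sign_on U w)"
    (is "_ * int (card ?F) = _")
proof -
  let ?n = "card A"
  let ?G = "extension_sign_sum w"
  define W where "W = (\<Sum>U\<in>Pow A. fact (card U) * fact (?n - card U) * ?G U U)"
  let ?h = "\<lambda>U a. fact (?n - card U) * (fact (card U - 1) * ?G U (U - {a}))"
  have "int ?n * int (card ?F) =
      (\<Sum>U\<in>Pow A. fact (?n - card U) * (fact (card U) * ?G U U - (\<Sum>a\<in>U. fact (card U - 1) * ?G U (U - {a}))))"
    unfolding card_cyclic_factorizations_extensions[OF assms]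
    using fin finite_subset by (intro sum.cong refl arg_cong2[where f = "(*)"] sum_extension_sign_sum) auto
  also have "\<dots> = W - (\<Sum>U\<in>Pow A. \<Sum>a | a \<in> A \<and> a \<in> U. ?h U a)"
    unfolding W_def sum_subtractf[symmetric]
  proof (intro sum.cong refl)
    fix U assume "U \<in> Pow A"
    then have "{a. a \<in> A \<and> a \<in> U} = U" by auto
    then show "fact (?n - card U) * (fact (card U) * ?G U U - (\<Sum>a\<in>U. fact (card U - 1) * ?G U (U - {a}))) =
        fact (card U) * fact (?n - card U) * ?G U U - (\<Sum>a | a \<in> A \<and> a \<in> U. ?h U a)"
      by (simp add: sum_distrib_left right_diff_distrib mult_ac)
  qed
  also have "(\<Sum>U\<in>Pow A. \<Sum>a | a \<in> A \<and> a \<in> U. ?h U a) = (\<Sum>a\<in>A. \<Sum>U | U \<in> Pow A \<and> a \<in> U. ?h U a)"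
    using fin by (intro sum.swap_restrict) auto
  finally have main: "int ?n * int (card ?F) = W - (\<Sum>a\<in>A. \<Sum>U | U \<in> Pow A \<and> a \<in> U. ?h U a)" .
  have "int ?n * int (?n + 1) * int (card ?F) = int (?n + 1) * (int ?n * int (card ?F))"
    by (simp only: mult_ac)
  also have "\<dots> = int (?n + 1) * W - (\<Sum>a\<in>A. int (?n + 1) * (\<Sum>U | U \<in> Pow A \<and> a \<in> U. ?h U a))"
    unfolding main by (simp only: right_diff_distrib sum_distrib_left)
  also have "\<dots> = int (?n + 1) * W - (\<Sum>a\<in>A. W)"
    unfolding W_def
    by (intro arg_cong2[where f = "(-)"] refl sum.cong sum_almost_extension_sign_sum[OF fin w])
  also have "\<dots> = W" by (simp add: algebra_simps)
  also have "W = (\<Sum>U\<in>Pow A. if w ` U = U then fact (card U) * fact (?n - card U) * sign_on U w else 0)"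
    unfolding W_def extension_sign_sum_self[OF w] by (intro sum.cong) auto
  also have "\<dots> = (\<Sum>U | U \<subseteq> A \<and> w ` U = U. fact (card U) * fact (?n - card U) * sign_on U w)"
    using fin by (intro sum.mono_neutral_cong_right) auto
  finally show ?thesis .
qed

section \<open>The integral over the unit interval\<close>

text \<open>The Beta integral, by induction on \<open>b\<close>: splitting off a factor
  \<open>1 - x\<close> gives a difference of two integrals with exponent \<open>b\<close>, one of
  them with \<open>a\<close> raised by one. Hence \<open>a\<close> must be arbitrary.\<close>

lemma has_integral_power_mult_power:
  "((\<lambda>x. x ^ a * (1 - x) ^ b) has_integral fact a * fact b / fact (a + b + 1)) {0..1::real}"
proof (induction b arbitrary: a)
  case 0
  have "((\<lambda>x. x ^ Suc a / real (Suc a)) has_real_derivative x ^ a) (at x within {0..1})" for x :: real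
    by (rule DERIV_cong[OF DERIV_cdivide[OF DERIV_pow]]) (simp del: of_nat_Suc)
  then have "((\<lambda>x. x ^ a) has_integral (1 ^ Suc a / Suc a - 0 ^ Suc a / Suc a)) {0..1::real}"
    by (intro fundamental_theorem_of_calculus)
      (simp_all only: has_real_derivative_iff_has_vector_derivative zero_le_one)
  moreover have "(1 ^ Suc a / Suc a - 0 ^ Suc a / Suc a :: real) = fact a * fact 0 / fact (a + 0 + 1)"
    by (simp del: of_nat_Suc)
  ultimately show ?case by simp
next
  case (Suc b)
  have "((\<lambda>x. x ^ a * (1 - x) ^ b - x ^ Suc a * (1 - x) ^ b) has_integral
      (fact a * fact b / fact (a + b + 1) - fact (Suc a) * fact b / fact (Suc a + b + 1))) {0..1::real}"
    by (intro has_integral_diff Suc.IH)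
  also have "(\<lambda>x::real. x ^ a * (1 - x) ^ b - x ^ Suc a * (1 - x) ^ b) = (\<lambda>x. x ^ a * (1 - x) ^ Suc b)"
    by (simp add: fun_eq_iff algebra_simps)
  also have "(fact a * fact b / fact (a + b + 1) - fact (Suc a) * fact b / fact (Suc a + b + 1) :: real) =
      fact a * fact (Suc b) / fact (a + Suc b + 1)"
  proof -
    define F c :: real where "F = fact (a + b + 1)" and "c = real a + real b + 2"
    have F: "F \<noteq> 0" "c \<noteq> 0" by (simp_all add: F_def c_def)
    have "fact (Suc a + b + 1) = c * F" by (simp add: F_def c_def algebra_simps)
    moreover have "a + Suc b + 1 = Suc a + b + 1" by simp
    moreover have "x / F - real (Suc a) * x / (c * F) = real (Suc b) * x / (c * F)" for x
      using F by (simp add: field_simps) (simp add: c_def algebra_simps)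
    from this[of "fact a * fact b"]
    have "fact a * fact b / F - fact (Suc a) * fact b / (c * F) = fact a * fact (Suc b) / (c * F)"
      by (simp add: mult_ac)
    ultimately show ?thesis by (simp only: F_def)
  qed
  finally show ?case .
qed

lemma has_integral_reflect_unit:
  fixes f :: "real \<Rightarrow> real"
  assumes "(f has_integral I) {0..1}"
  shows "((\<lambda>x. f (1 - x)) has_integral I) {0..1}"
proof -
  have "(\<lambda>x. 1 - x) ` {0..1} = {0..1::real}"
  proof (intro equalityI subsetI)
    fix x :: real assume "x \<in> {0..1}"
    then show "x \<in> (\<lambda>x. 1 - x) ` {0..1}" by (intro image_eqI[of _ _ "1 - x"]) auto
  qed auto
  then show ?thesis
    using has_integral_affinity[of f I 0 1 "-1" 1] assms by simp
qed

text \<open>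
  The factor of a cycle of length \<open>m\<close>: with respect to the weight \<open>x\<close> for the points inside and \<open>1 - x\<close>
  for the points outside an invariant set, it sums the two choices for this cycle, with sign.
\<close>

definition cycle_factor :: "nat \<Rightarrow> real \<Rightarrow> real" where
  "cycle_factor m x = (1 - x) ^ m - (- x) ^ m"

text \<open>The factor that appears is the sign of a cycle of length \<open>m\<close>, so the
  product over all cycles of an even permutation is symmetric under the reflection.\<close>

lemma cycle_factor_reflect: "cycle_factor m (1 - x) = - ((- 1) ^ m) * cycle_factor m x"
proof -
  have "(- (1 - x)) ^ m = (- 1) ^ m * (1 - x) ^ m" "(- x) ^ m = (- 1) ^ m * x ^ m"
    by (metis mult_minus1 power_mult_distrib)+
  then show ?thesis by (simp add: cycle_factor_def algebra_simps flip: power_add power_mult_distrib)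
qed

text \<open>The term of degree \<open>m\<close> in the binomial expansion cancels against
  \<open>(- x) ^ m\<close>; this is the origin of the strict bound on the summation indices.\<close>

lemma cycle_factor_expand: "cycle_factor m x = (\<Sum>j\<in>{0..<m}. real (m choose j) * (- x) ^ j)"
proof -
  have "(1 - x) ^ m = (\<Sum>j\<le>m. real (m choose j) * (- x) ^ j)"
    using binomial_ring[of "- x" 1 m] by (simp add: algebra_simps)
  also have "{..m} = insert m {0..<m}" by auto
  finally show ?thesis by (simp add: cycle_factor_def)
qed

section \<open>Invariant sets as unions of orbits\<close>

lemma orbit_family:
  assumes fin: "finite A" and w: "w permutes A"
  shows "\<Union>(orbit w ` A) = A"
    and "C \<in> orbit w ` A \<Longrightarrow> C \<subseteq> A \<and> C \<noteq> {} \<and> w ` C = C \<and> cyclic_on w C"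
    and "C \<in> orbit w ` A \<Longrightarrow> D \<in> orbit w ` A \<Longrightarrow> C \<noteq> D \<Longrightarrow> C \<inter> D = {}"
proof -
  have self: "x \<in> orbit w x" for x
    using permutes_imp_permutation[OF fin w] by (rule permutation_self_in_orbit)
  have sub: "orbit w x \<subseteq> A" if "x \<in> A" for x using w that by (rule permutes_orbit_subset)
  show "\<Union>(orbit w ` A) = A" using self sub by blast
  have cyc: "cyclic_on w (orbit w x)" for x using w fin by (rule cyclic_on_orbit)
  have image: "w ` orbit w x = orbit w x" if "x \<in> A" for x
  proof (rule endo_inj_surj)
    show "finite (orbit w x)" using sub[OF that] fin by (rule finite_subset)
    show "w ` orbit w x \<subseteq> orbit w x" by (auto intro: orbit.step)
    show "inj_on w (orbit w x)" using w by (rule permutes_inj_on)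
  qed
  show "C \<subseteq> A \<and> C \<noteq> {} \<and> w ` C = C \<and> cyclic_on w C" if "C \<in> orbit w ` A"
    using that sub image cyc self by blast
  show "C \<inter> D = {}" if "C \<in> orbit w ` A" "D \<in> orbit w ` A" "C \<noteq> D"
  proof (rule ccontr)
    assume "C \<inter> D \<noteq> {}"
    then obtain z where z: "z \<in> C" "z \<in> D" by auto
    have "cyclic_on w C" "cyclic_on w D" using that(1,2) cyc by auto
    then have "orbit w z = C" "orbit w z = D" using z by (auto dest: orbit_cyclic_eq3)
    then show False using that(3) by simp
  qed
qed

text \<open>An invariant set contains the orbit of each of its points, and disjointness of the
  orbits makes the decomposition unique.\<close>

lemma Union_orbits_invariant:
  assumes fin: "finite A" and w: "w permutes A"
  shows "bij_betw \<Union> (Pow (orbit w ` A)) {U. U \<subseteq> A \<and> w ` U = U}"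
proof (rule bij_betw_byWitness[where f' = "\<lambda>U. {C \<in> orbit w ` A. C \<subseteq> U}"])
  note O = orbit_family[OF fin w]
  show "\<forall>J\<in>Pow (orbit w ` A). {C \<in> orbit w ` A. C \<subseteq> \<Union>J} = J"
  proof (intro ballI equalityI subsetI)
    fix J C assume J: "J \<in> Pow (orbit w ` A)" and C: "C \<in> {C \<in> orbit w ` A. C \<subseteq> \<Union>J}"
    then obtain z where z: "z \<in> C" using O(2) by blast
    then obtain D where "D \<in> J" "z \<in> D" using C by blast
    then show "C \<in> J" using z O(3)[of C D] C J by blast
  qed auto
  show "\<forall>U\<in>{U. U \<subseteq> A \<and> w ` U = U}. \<Union>{C \<in> orbit w ` A. C \<subseteq> U} = U"
  proof (intro ballI equalityI subsetI)
    fix U x assume U: "U \<in> {U. U \<subseteq> A \<and> w ` U = U}" and x: "x \<in> U"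
    have "orbit w x \<subseteq> U"
    proof
      fix y assume "y \<in> orbit w x"
      then show "y \<in> U" by induct (use U x in auto)
    qed
    moreover have "x \<in> orbit w x"
      using permutes_imp_permutation[OF fin w] by (rule permutation_self_in_orbit)
    ultimately show "x \<in> \<Union>{C \<in> orbit w ` A. C \<subseteq> U}" using U x by blast
  qed auto
  show "\<Union> ` Pow (orbit w ` A) \<subseteq> {U. U \<subseteq> A \<and> w ` U = U}"
  proof clarify
    fix J assume J: "J \<subseteq> orbit w ` A"
    have "w ` \<Union>J = (\<Union>C\<in>J. w ` C)" by blast
    also have "\<dots> = (\<Union>C\<in>J. C)"
    proof (intro SUP_cong refl)
      fix C assume "C \<in> J"
      then show "w ` C = C" using O(2)[of C] J by auto
    qed
    finally have "w ` \<Union>J = \<Union>J" by simp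
    then show "\<Union>J \<subseteq> A \<and> w ` \<Union>J = \<Union>J" using O(1) J by blast
  qed
  show "(\<lambda>U. {C \<in> orbit w ` A. C \<subseteq> U}) ` {U. U \<subseteq> A \<and> w ` U = U} \<subseteq> Pow (orbit w ` A)" by auto
qed

lemma sign_on_Union_orbits:
  assumes fin: "finite A" and w: "w permutes A" and J: "J \<subseteq> orbit w ` A"
  shows "sign_on (\<Union>J) w = (\<Prod>C\<in>J. - ((- 1) ^ card C))"
    and "card (\<Union>J) = (\<Sum>C\<in>J. card C)"
proof -
  note O = orbit_family[OF fin w]
  have finJ: "finite J" by (rule finite_subset[OF J finite_imageI[OF fin]])
  show "card (\<Union>J) = (\<Sum>C\<in>J. card C)"
  proof (rule card_Union_disjoint)
    show "pairwise disjnt J"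
      using J by (intro pairwiseI) (simp add: disjnt_def O(3) subset_iff)
    show "finite C" if "C \<in> J" for C
    proof (rule finite_subset[OF _ fin])
      show "C \<subseteq> A" using that J O(2)[of C] by auto
    qed
  qed
  show "sign_on (\<Union>J) w = (\<Prod>C\<in>J. - ((- 1) ^ card C))"
    using finJ J
  proof (induction J rule: finite_induct)
    case empty
    show ?case by (simp add: sign_on_def restrict_id_def)
  next
    case (insert C J)
    have C: "C \<subseteq> A" "C \<noteq> {}" "w ` C = C" "cyclic_on w C" using O(2)[of C] insert.prems by auto
    have "finite C" using C(1) fin by (rule finite_subset)
    have "cyclic_on (restrict_id w C) C"
      using C(4) cyclic_cong[of C "restrict_id w C" w] by simp
    then have "(- 1) ^ card C * sign_on C w = - 1"
      unfolding sign_on_def using \<open>finite C\<close> C(2) permutes_restrict_id_invariant[OF w C(3)]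
      by (intro sign_cyclic_on)
    then have sgnC: "sign_on C w = - ((- 1) ^ card C)"
      by (cases "even (card C)") auto
    have "w ` \<Union>J = (\<Union>D\<in>J. w ` D)" by blast
    also have "\<dots> = (\<Union>D\<in>J. D)"
    proof (intro SUP_cong refl)
      fix D assume "D \<in> J"
      then show "w ` D = D" using O(2)[of D] insert.prems by auto
    qed
    finally have "w ` \<Union>J = \<Union>J" by simp
    moreover have "\<Union>J \<subseteq> A" using O(1) insert.prems by blast
    moreover have "C \<inter> D = {}" if "D \<in> J" for D
      using O(3)[of C D] insert.prems insert.hyps(2) that by auto
    then have "C \<inter> \<Union>J = {}" by blast
    ultimately have "sign_on (C \<union> \<Union>J) w = sign_on C w * sign_on (\<Union>J) w"
      using C by (intro sign_on_Un[OF w fin])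
    then show ?case using insert sgnC by simp
  qed
qed

text \<open>Expanding the product chooses a set \<open>J\<close> of orbits that contribute powers of
  \<open>x\<close>, hence the invariant set \<open>\<Union>J\<close> with its sign. Termwise Beta
  integration gives the sum of \<open>card_cyclic_factorizations\<close> divided by
  \<open>fact (card A + 1)\<close>.\<close>

theorem card_cyclic_factorizations_integral:
  assumes fin: "finite A" and A: "A \<noteq> {}" and w: "w permutes A"
  shows "((\<lambda>x. fact (card A - 1) * (\<Prod>C\<in>orbit w ` A. cycle_factor (card C) x)) has_integral
      real (card {c. c permutes A \<and> cyclic_on c A \<and> cyclic_on (inv c \<circ> w) A})) {0..1}"
    (is "(_ has_integral real (card ?F)) _")
proof -
  let ?n = "card A"
  let ?O = "orbit w ` A"
  note O = orbit_family[OF fin w]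
  have finO: "finite ?O" using fin by simp
  have finC: "finite C" if "C \<in> ?O" for C using O(2)[OF that] fin finite_subset by auto
  let ?c = "\<lambda>J. real_of_int (sign_on (\<Union>J) w)"
  have expand: "(\<Prod>C\<in>?O. cycle_factor (card C) x) =
      (\<Sum>J\<in>Pow ?O. ?c J * (x ^ card (\<Union>J) * (1 - x) ^ (?n - card (\<Union>J))))" for x
  proof -
    have "(\<Prod>C\<in>?O. cycle_factor (card C) x) = (\<Prod>C\<in>?O. - ((- x) ^ card C) + (1 - x) ^ card C)"
      by (intro prod.cong) (simp_all add: cycle_factor_def)
    also have "\<dots> = (\<Sum>J\<in>Pow ?O. (\<Prod>C\<in>J. - ((- x) ^ card C)) * (\<Prod>C\<in>?O - J. (1 - x) ^ card C))"
      using finO by (rule prod_add)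
    also have "\<dots> = (\<Sum>J\<in>Pow ?O. ?c J * (x ^ card (\<Union>J) * (1 - x) ^ (?n - card (\<Union>J))))"
    proof (intro sum.cong refl)
      fix J assume "J \<in> Pow ?O"
      then have J: "J \<subseteq> ?O" by simp
      have "(\<Prod>C\<in>J. - ((- x) ^ card C)) = (\<Prod>C\<in>J. - ((- 1) ^ card C) * x ^ card C)"
        by (intro prod.cong refl) (metis mult_minus1 mult_minus_left power_mult_distrib)
      also have "\<dots> = ?c J * x ^ card (\<Union>J)"
        unfolding sign_on_Union_orbits[OF fin w J] prod.distrib by (simp add: power_sum)
      finally have 1: "(\<Prod>C\<in>J. - ((- x) ^ card C)) = ?c J * x ^ card (\<Union>J)" .
      have "?n = card (\<Union>?O)" by (simp only: O(1))
      also have "\<dots> = (\<Sum>C\<in>?O. card C)" by (intro sign_on_Union_orbits(2)[OF fin w]) simp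
      also have "\<dots> = (\<Sum>C\<in>?O - J. card C) + card (\<Union>J)"
        unfolding sign_on_Union_orbits(2)[OF fin w J] using J finO by (rule sum.subset_diff)
      finally have "(\<Sum>C\<in>?O - J. card C) = ?n - card (\<Union>J)" by simp
      then have 2: "(\<Prod>C\<in>?O - J. (1 - x) ^ card C) = (1 - x) ^ (?n - card (\<Union>J))"
        by (simp flip: power_sum)
      show "(\<Prod>C\<in>J. - ((- x) ^ card C)) * (\<Prod>C\<in>?O - J. (1 - x) ^ card C) =
          ?c J * (x ^ card (\<Union>J) * (1 - x) ^ (?n - card (\<Union>J)))"
        unfolding 1 2 by simp
    qed
    finally show ?thesis .
  qed
  have le: "card (\<Union>J) \<le> ?n" if "J \<in> Pow ?O" for J
    using that O(1) fin by (intro card_mono) auto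
  have "((\<lambda>x. \<Sum>J\<in>Pow ?O. ?c J * (x ^ card (\<Union>J) * (1 - x) ^ (?n - card (\<Union>J)))) has_integral
      (\<Sum>J\<in>Pow ?O. ?c J * (fact (card (\<Union>J)) * fact (?n - card (\<Union>J)) /
        fact (card (\<Union>J) + (?n - card (\<Union>J)) + 1)))) {0..1}"
    using finO by (intro has_integral_sum has_integral_mult_right has_integral_power_mult_power) auto
  moreover have "(\<Sum>J\<in>Pow ?O. ?c J * (fact (card (\<Union>J)) * fact (?n - card (\<Union>J)) /
        fact (card (\<Union>J) + (?n - card (\<Union>J)) + 1))) =
      (\<Sum>J\<in>Pow ?O. fact (card (\<Union>J)) * fact (?n - card (\<Union>J)) * ?c J) / fact (?n + 1)"
    unfolding sum_divide_distrib using le by (intro sum.cong) simp_all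
  moreover have "(\<Sum>J\<in>Pow ?O. fact (card (\<Union>J)) * fact (?n - card (\<Union>J)) * ?c J) =
      (\<Sum>U | U \<subseteq> A \<and> w ` U = U. fact (card U) * fact (?n - card U) * real_of_int (sign_on U w))"
    by (rule sum.reindex_bij_betw[OF Union_orbits_invariant[OF fin w]])
  moreover have "\<dots> = real_of_int (\<Sum>U | U \<subseteq> A \<and> w ` U = U. fact (card U) * fact (?n - card U) * sign_on U w)"
    by simp
  moreover have "\<dots> = real ?n * real (?n + 1) * real (card ?F)"
    unfolding card_cyclic_factorizations[OF assms, symmetric] by simp
  ultimately have "((\<lambda>x. \<Prod>C\<in>?O. cycle_factor (card C) x) has_integral
      real ?n * real (?n + 1) * real (card ?F) / fact (?n + 1)) {0..1}"
    unfolding expand by (simp only:)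
  then have "((\<lambda>x. fact (?n - 1) * (\<Prod>C\<in>?O. cycle_factor (card C) x)) has_integral
      fact (?n - 1) * (real ?n * real (?n + 1) * real (card ?F) / fact (?n + 1))) {0..1}"
    by (rule has_integral_mult_right)
  moreover have "fact (?n - 1) * (real ?n * real (?n + 1) * real (card ?F) / fact (?n + 1)) = real (card ?F)"
  proof -
    have "?n > 0" using fin A by (simp add: card_gt_0_iff)
    then have "(fact (?n + 1) :: real) = real (?n + 1) * (real ?n * fact (?n - 1))"
      by (simp add: fact_reduce[of ?n])
    moreover have "real (?n + 1) * (real ?n * fact (?n - 1)) \<noteq> 0" using \<open>?n > 0\<close> by simp
    ultimately show ?thesis by (simp add: field_simps)
  qed
  ultimately show ?thesis by (simp only:)
qed

section \<open>Evaluation of the integral in terms of the parts\<close>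

lemma falling_factorial_fact: "falling_factorial (real (m + r)) r = fact (m + r) / fact m"
proof (induction r)
  case 0
  show ?case by (simp add: falling_factorial_def)
next
  case (Suc r)
  have "falling_factorial (real (m + Suc r)) (Suc r) =
      real (m + Suc r) * (\<Prod>i<r. real (m + Suc r) - of_nat (Suc i))"
    unfolding falling_factorial_def by (subst prod.lessThan_Suc_shift) simp
  also have "(\<Prod>i<r. real (m + Suc r) - of_nat (Suc i)) = falling_factorial (real (m + r)) r"
    unfolding falling_factorial_def by (intro prod.cong) simp_all
  finally show ?case using Suc.IH by simp
qed

text \<open>The hypothesis \<open>even\<close> says that the signs of the cycles multiply to 1. Only
  the factors with \<open>t \<ge> 2\<close> are expanded; the factor for \<open>t = 1\<close> has
  two terms with equal integrals, whence the 2.\<close>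

lemma integral_cycle_factors:
  fixes lam :: "nat \<Rightarrow> nat"
  assumes k: "1 \<le> k" and even: "(\<Prod>t=1..k. - ((- 1) ^ lam t)) = (1::real)"
  shows "((\<lambda>x. \<Prod>t=1..k. cycle_factor (lam t) x) has_integral
    2 * (\<Sum>j \<in> (\<Pi>\<^sub>E t\<in>{2..k}. {0..<lam t}).
         let l = (\<Sum>t=2..k. j t) in
           (- 1) ^ l * (fact l / falling_factorial (real (lam 1 + l + 1)) (l + 1)) *
           (\<Prod>t=2..k. real (lam t choose j t)))) {0..1}"
    (is "(_ has_integral 2 * ?S) _")
proof -
  let ?E = "\<Pi>\<^sub>E t\<in>{2..k}. {0..<lam t}"
  define Q where "Q x = (\<Prod>t=2..k. cycle_factor (lam t) x)" for x
  have range: "{1..k} = insert 1 {2..k}" using k by auto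
  have finE: "finite ?E" by (intro finite_PiE) auto
  let ?c = "\<lambda>j. (- 1) ^ (\<Sum>t=2..k. j t) * (\<Prod>t=2..k. real (lam t choose j t))"
  have Q: "Q x = (\<Sum>j\<in>?E. ?c j * x ^ (\<Sum>t=2..k. j t))" for x
  proof -
    have "Q x = (\<Prod>t=2..k. \<Sum>i\<in>{0..<lam t}. real (lam t choose i) * (- x) ^ i)"
      by (simp add: Q_def cycle_factor_expand)
    also have "\<dots> = (\<Sum>j\<in>?E. \<Prod>t=2..k. real (lam t choose j t) * (- x) ^ j t)"
      by (rule prod_sum_PiE) auto
    also have "\<dots> = (\<Sum>j\<in>?E. ?c j * x ^ (\<Sum>t=2..k. j t))"
    proof (intro sum.cong refl)
      fix j :: "nat \<Rightarrow> nat"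
      have "(- x) ^ (\<Sum>t=2..k. j t) = (- 1) ^ (\<Sum>t=2..k. j t) * x ^ (\<Sum>t=2..k. j t)"
        by (metis mult_minus1 power_mult_distrib)
      then show "(\<Prod>t=2..k. real (lam t choose j t) * (- x) ^ j t) = ?c j * x ^ (\<Sum>t=2..k. j t)"
        by (simp add: prod.distrib flip: power_sum)
    qed
    finally show ?thesis .
  qed
  have "((\<lambda>x. \<Sum>j\<in>?E. ?c j * (x ^ (\<Sum>t=2..k. j t) * (1 - x) ^ lam 1)) has_integral
      (\<Sum>j\<in>?E. ?c j * (fact (\<Sum>t=2..k. j t) * fact (lam 1) / fact ((\<Sum>t=2..k. j t) + lam 1 + 1)))) {0..1}"
    using finE by (intro has_integral_sum has_integral_mult_right has_integral_power_mult_power) auto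
  also have "(\<lambda>x. \<Sum>j\<in>?E. ?c j * (x ^ (\<Sum>t=2..k. j t) * (1 - x) ^ lam 1)) = (\<lambda>x. (1 - x) ^ lam 1 * Q x)"
    by (simp add: fun_eq_iff Q sum_distrib_left mult_ac)
  also have "(\<Sum>j\<in>?E. ?c j * (fact (\<Sum>t=2..k. j t) * fact (lam 1) / fact ((\<Sum>t=2..k. j t) + lam 1 + 1))) = ?S"
  proof (intro sum.cong refl)
    fix j :: "nat \<Rightarrow> nat"
    define l where "l = (\<Sum>t=2..k. j t)"
    have "falling_factorial (real (lam 1 + l + 1)) (l + 1) = fact (lam 1 + l + 1) / fact (lam 1)"
      using falling_factorial_fact[of "lam 1" "l + 1"] by (simp only: add.assoc)
    then show "?c j * (fact (\<Sum>t=2..k. j t) * fact (lam 1) / fact ((\<Sum>t=2..k. j t) + lam 1 + 1)) =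
        (let l = (\<Sum>t=2..k. j t) in
           (- 1) ^ l * (fact l / falling_factorial (real (lam 1 + l + 1)) (l + 1)) *
           (\<Prod>t=2..k. real (lam t choose j t)))"
      unfolding Let_def l_def[symmetric] by (simp add: add.commute[of l] mult_ac)
  qed
  finally have part: "((\<lambda>x. (1 - x) ^ lam 1 * Q x) has_integral ?S) {0..1}" .
  \<comment> \<open>The signs of the cycles from 2 to \<open>k\<close> multiply to the sign of the
    first cycle, as the full product is 1.\<close>
  have Q_reflect: "Q (1 - x) = - ((- 1) ^ lam 1) * Q x" for x
  proof -
    have "Q (1 - x) = (\<Prod>t=2..k. - ((- 1) ^ lam t)) * Q x"
      by (simp only: Q_def cycle_factor_reflect prod.distrib)
    moreover have "- ((- 1) ^ lam 1) * (\<Prod>t=2..k. - ((- 1) ^ lam t)) = (1::real)"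
      using even unfolding range by simp
    then have "(\<Prod>t=2..k. - ((- 1) ^ lam t)) = (- ((- 1) ^ lam 1) :: real)"
      by (cases "even (lam 1)") auto
    ultimately show ?thesis by simp
  qed
  \<comment> \<open>The reflection exchanges the two terms of the first factor: the sign produced by
    \<open>Q\<close> is the one needed to turn \<open>x ^ lam 1\<close> into
    \<open>- ((- x) ^ lam 1)\<close>.\<close>
  have "(1 - (1 - x)) ^ lam 1 * Q (1 - x) = - ((- x) ^ lam 1) * Q x" for x
  proof -
    have "(- x) ^ lam 1 = (- 1) ^ lam 1 * x ^ lam 1" by (metis mult_minus1 power_mult_distrib)
    then show ?thesis by (simp add: Q_reflect)
  qed
  then have "((\<lambda>x. - ((- x) ^ lam 1) * Q x) has_integral ?S) {0..1}"
    using has_integral_reflect_unit[OF part] by simp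
  from has_integral_add[OF part this]
  have "((\<lambda>x. (1 - x) ^ lam 1 * Q x + - ((- x) ^ lam 1) * Q x) has_integral ?S + ?S) {0..1}" .
  moreover have "(1 - x) ^ lam 1 * Q x + - ((- x) ^ lam 1) * Q x = (\<Prod>t=1..k. cycle_factor (lam t) x)" for x
    unfolding range by (simp add: Q_def cycle_factor_def left_diff_distrib)
  ultimately show ?thesis by (simp only: mult_2)
qed

theorem theorem1p5:
  fixes n k :: nat and lam :: "nat \<Rightarrow> nat" and \<omega> :: "nat \<Rightarrow> nat"
  assumes "1 \<le> k"
    and "int_partition n k lam"
    and "\<omega> permutes {1..n}"
    and "evenperm \<omega>"
    and "has_cycle_type n \<omega> k lam"
  shows "real (card {(\<sigma>, \<tau>). n_cycle n \<sigma> \<and> n_cycle n \<tau> \<and> \<sigma> \<circ> \<tau> = \<omega>}) =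
    2 * fact (n - 1) *
      (\<Sum>j \<in> (\<Pi>\<^sub>E t\<in>{2..k}. {0..<lam t}).
         let l = (\<Sum>t=2..k. j t) in
           (- 1) ^ l * (fact l / falling_factorial (real (lam 1 + l + 1)) (l + 1)) *
           (\<Prod>t=2..k. real (lam t choose j t)))"
    (is "real (card ?F) = 2 * fact (n - 1) * ?S")
proof -
  let ?A = "{1..n}"
  let ?O = "orbit \<omega> ` ?A"
  let ?C = "{c. c permutes ?A \<and> cyclic_on c ?A \<and> cyclic_on (inv c \<circ> \<omega>) ?A}"
  have A: "?A \<noteq> {}"
  proof -
    have "0 < lam 1" "lam 1 \<le> (\<Sum>t=1..k. lam t)"
      using assms(1,2) by (auto simp: int_partition_def intro: member_le_sum)
    then show ?thesis using assms(2) by (auto simp: int_partition_def)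
  qed
  \<comment> \<open>Equal multisets of cycle lengths let products over orbits become products over
    parts. This is used for the signs and for the cycle factors.\<close>
  have transfer: "(\<Prod>C\<in>?O. h (card C)) = (\<Prod>t=1..k. h (lam t))" for h :: "nat \<Rightarrow> real"
  proof -
    have "image_mset h (image_mset card (mset_set ?O)) = image_mset h (image_mset lam (mset_set {1..k}))"
      using assms(5) by (simp add: has_cycle_type_def cycle_type_def)
    then have "(\<Prod>C\<in>#mset_set ?O. h (card C)) = (\<Prod>t\<in>#mset_set {1..k}. h (lam t))"
      by (simp add: image_mset.compositionality o_def)
    then show ?thesis by (simp add: prod_unfold_prod_mset)
  qed
  have "sign \<omega> = 1" using assms(4) by (simp add: sign_def)
  moreover have "sign \<omega> = sign_on (\<Union>?O) \<omega>"
    using sign_on_permutes[OF assms(3) subset_refl] orbit_family(1)[OF finite_atLeastAtMost assms(3)]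
    by simp
  ultimately have "real_of_int (\<Prod>C\<in>?O. - ((- 1) ^ card C)) = 1"
    using sign_on_Union_orbits(1)[OF finite_atLeastAtMost assms(3) subset_refl] by simp
  then have "(\<Prod>t=1..k. - ((- 1) ^ lam t)) = (1::real)"
    using transfer[of "\<lambda>m. - ((- 1) ^ m)"] by simp
  from integral_cycle_factors[OF assms(1) this]
  have "((\<lambda>x. fact (n - 1) * (\<Prod>t=1..k. cycle_factor (lam t) x)) has_integral
      fact (n - 1) * (2 * ?S)) {0..1}"
    by (rule has_integral_mult_right)
  moreover have "((\<lambda>x. fact (n - 1) * (\<Prod>t=1..k. cycle_factor (lam t) x)) has_integral
      real (card ?C)) {0..1}"
    using card_cyclic_factorizations_integral[OF _ A assms(3)]
      transfer[of "\<lambda>m. cycle_factor m _"] by simp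
  ultimately have "real (card ?C) = fact (n - 1) * (2 * ?S)" by (rule has_integral_unique[rotated])
  \<comment> \<open>The second factor is determined by the first as
    \<open>inv \<sigma> \<circ> \<omega>\<close>, so pairs correspond to single cycles.\<close>
  moreover have "bij_betw fst ?F ?C"
  proof (rule bij_betw_byWitness[where f' = "\<lambda>c. (c, inv c \<circ> \<omega>)"])
    have left: "inv \<sigma> \<circ> (\<sigma> \<circ> \<tau>) = \<tau>" if "n_cycle n \<sigma>" for \<sigma> \<tau> :: "nat \<Rightarrow> nat"
      using that permutes_inv_o(2)[of \<sigma> ?A] by (simp add: n_cycle_def o_assoc)
    show "\<forall>a\<in>?F. (fst a, inv (fst a) \<circ> \<omega>) = a" using left by auto
    show "\<forall>c\<in>?C. fst (c, inv c \<circ> \<omega>) = c" by simp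
    show "fst ` ?F \<subseteq> ?C" using left by (auto simp: n_cycle_def)
    show "(\<lambda>c. (c, inv c \<circ> \<omega>)) ` ?C \<subseteq> ?F"
      using assms(3) by (auto simp: n_cycle_def o_assoc permutes_inv_o intro: permutes_compose permutes_inv)
  qed
  then have "card ?F = card ?C" by (rule bij_betw_same_card)
  ultimately show ?thesis by (simp only: mult_ac)
qed

end
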